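(* Consider the potential $v \in L^{\infty}(\mathbb{R})$ defined by $$v(x) := \frac{\mathbf{1}_{x\geq 1}}{x^2},$$ that is, $v(x)=1/x^2$ for $x\geq 1$ and $v(x)=0$ for $x<1$. Then there exist constants $0<\alpha<\beta$ such that $$\frac{\alpha}{L^2} \leq \Gamma_v(L) \leq \frac{\beta}{L^2}$$ for all $L>0$ large enough.
   Context: For a bounded non-negative potential $v:\mathbb{R}\to\mathbb{R}_{\geq 0}$ and $L>0$, let $h^D_L = -\frac{\mathrm{d}^2}{\mathrm{d}x^2}+v(x)$ be the self-adjoint Schrödinger operator on $L^2((-L/2,+L/2))$ with Dirichlet boundary conditions at $x=\pm L/2$. It has purely discrete spectrum; its eigenvalues, counted with multiplicity, are $\varepsilon_0(L) < \varepsilon_1(L) \leq \dots$. The spectral gap is $\Gamma_v(L) := \varepsilon_1(L)-\varepsilon_0(L)$. *)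

theory Defs
  imports "HOL-Analysis.Analysis" "HOL-Library.Function_Algebras"
begin

definition square_integrable_on :: "(real \<Rightarrow> complex) \<Rightarrow> real set \<Rightarrow> bool" where
  "square_integrable_on f S \<longleftrightarrow>
     set_borel_measurable lebesgue S f \<and>
     set_integrable lebesgue S (\<lambda>x. (cmod (f x))\<^sup>2)"

text \<open>
  Membership in the Sobolev space \<open>H\<^sup>2((a,b))\<close>, for the continuous representative
  \<open>u\<close> on \<open>[a,b]\<close>: \<open>u\<close> is differentiable (one-sidedly at the end points) with an absolutely
  continuous derivative \<open>u1\<close>, whose a.e. derivative \<open>u2\<close> is in \<open>L\<^sup>2((a,b))\<close>.
\<close>

definition H2_with_derivs ::
  "real \<Rightarrow> real \<Rightarrow> (real \<Rightarrow> complex) \<Rightarrow> (real \<Rightarrow> complex) \<Rightarrow> (real \<Rightarrow> complex) \<Rightarrow> bool" where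
  "H2_with_derivs a b u u1 u2 \<longleftrightarrow>
     (\<forall>x\<in>{a..b}. (u has_vector_derivative u1 x) (at x within {a..b})) \<and>
     square_integrable_on u2 {a<..<b} \<and>
     (\<forall>x\<in>{a..b}. u1 x = u1 a + (LINT t:{a..x}|lebesgue. u2 t))"

text \<open>
  The operator \<open>-d\<^sup>2/dx\<^sup>2 + v\<close> on \<open>L\<^sup>2((-L/2, L/2))\<close> with domain \<open>H\<^sup>2 \<inter> H\<^sup>1\<^sub>0\<close>, given by its graph.
  An element of the domain is represented by its continuous representative, extended by zero
  to the real line, so that equal elements of the domain are equal functions; the requirement
  \<open>u x = 0\<close> at \<open>x = L/2\<close> and \<open>x = -L/2\<close> is the Dirichlet condition. The second component
  \<open>f\<close> is any representative of the image, i.e. it is determined up to null sets in the interval.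
\<close>

definition dirichlet_schroedinger ::
  "(real \<Rightarrow> real) \<Rightarrow> real \<Rightarrow> ((real \<Rightarrow> complex) \<times> (real \<Rightarrow> complex)) set" where
  "dirichlet_schroedinger v L =
     {(u, f).
        (\<forall>x. x \<notin> {-L/2<..<L/2} \<longrightarrow> u x = 0) \<and>
        square_integrable_on f {-L/2<..<L/2} \<and>
        (\<exists>u1 u2. H2_with_derivs (-L/2) (L/2) u u1 u2 \<and>
           (AE x in lebesgue. x \<in> {-L/2<..<L/2} \<longrightarrow>
              f x = - u2 x + complex_of_real (v x) * u x))}"

interpretation cfun: vector_space "\<lambda>(c::complex) (f::real \<Rightarrow> complex) x. c * f x"
  by unfold_locales (auto simp: fun_eq_iff algebra_simps)

text \<open>
  Eigenvalues of an operator given by its graph. Only real eigenvalues are considered, since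
  the operators of interest are self-adjoint.
\<close>

definition eigenspace ::
  "((real \<Rightarrow> complex) \<times> (real \<Rightarrow> complex)) set \<Rightarrow> real \<Rightarrow> (real \<Rightarrow> complex) set" where
  "eigenspace T \<mu> = {u. (u, \<lambda>x. complex_of_real \<mu> * u x) \<in> T}"

definition is_eigenvalue :: "((real \<Rightarrow> complex) \<times> (real \<Rightarrow> complex)) set \<Rightarrow> real \<Rightarrow> bool" where
  "is_eigenvalue T \<mu> \<longleftrightarrow> (\<exists>u\<in>eigenspace T \<mu>. u \<noteq> 0)"

definition eigenvalue_mult :: "((real \<Rightarrow> complex) \<times> (real \<Rightarrow> complex)) set \<Rightarrow> real \<Rightarrow> nat" where
  "eigenvalue_mult T \<mu> = cfun.dim (eigenspace T \<mu>)"

text \<open>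
  The \<open>n\<close>-th eigenvalue (starting from \<open>n = 0\<close>) in non-decreasing order, counted with
  multiplicity: the smallest \<open>c\<close> such that there are at least \<open>n + 1\<close> eigenvalues, counted with
  multiplicity, in \<open>(-\<infinity>, c]\<close>. The lemma below confirms that this is the \<open>n\<close>-th member of the
  non-decreasing enumeration whenever the operator has purely discrete spectrum bounded below.
\<close>

definition nth_eigenvalue :: "((real \<Rightarrow> complex) \<times> (real \<Rightarrow> complex)) set \<Rightarrow> nat \<Rightarrow> real" where
  "nth_eigenvalue T n =
     Inf {c. n < (\<Sum>\<mu> | is_eigenvalue T \<mu> \<and> \<mu> \<le> c. eigenvalue_mult T \<mu>)}"

lemma nth_eigenvalue_eqI:
  fixes e :: "nat \<Rightarrow> real"
  assumes "mono e"
    and fin: "\<And>c. finite {k. e k \<le> c}"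
    and ev: "\<And>\<mu>. is_eigenvalue T \<mu> \<longleftrightarrow> \<mu> \<in> range e"
    and mult: "\<And>\<mu>. is_eigenvalue T \<mu> \<Longrightarrow> card {k. e k = \<mu>} = eigenvalue_mult T \<mu>"
  shows "nth_eigenvalue T n = e n"
proof -
  have count: "(\<Sum>\<mu> | is_eigenvalue T \<mu> \<and> \<mu> \<le> c. eigenvalue_mult T \<mu>) = card {k. e k \<le> c}" for c
  proof -
    have "card {k. e k \<le> c} = (\<Sum>y\<in>e ` {k. e k \<le> c}. \<Sum>x | x \<in> {k. e k \<le> c} \<and> e x = y. 1)"
      unfolding card_eq_sum by (rule sum.image_gen[OF fin])
    also have "\<dots> = (\<Sum>y\<in>e ` {k. e k \<le> c}. eigenvalue_mult T y)"
    proof (rule sum.cong[OF refl])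
      fix y assume y: "y \<in> e ` {k. e k \<le> c}"
      then have "{x. x \<in> {k. e k \<le> c} \<and> e x = y} = {k. e k = y}" by auto
      moreover have "is_eigenvalue T y" using y ev by auto
      ultimately show "(\<Sum>x | x \<in> {k. e k \<le> c} \<and> e x = y. 1) = eigenvalue_mult T y"
        using mult by simp
    qed
    also have "e ` {k. e k \<le> c} = {\<mu>. is_eigenvalue T \<mu> \<and> \<mu> \<le> c}"
      using ev by auto
    finally show ?thesis by simp
  qed
  have "n < card {k. e k \<le> c} \<longleftrightarrow> e n \<le> c" for c
  proof
    assume "e n \<le> c"
    then have "{..n} \<subseteq> {k. e k \<le> c}" using monoD[OF \<open>mono e\<close>] order_trans by fastforce
    from card_mono[OF fin this] show "n < card {k. e k \<le> c}" by simp
  next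
    assume n: "n < card {k. e k \<le> c}"
    show "e n \<le> c"
    proof (rule ccontr)
      assume "\<not> e n \<le> c"
      then have "{k. e k \<le> c} \<subseteq> {..<n}"
        using monoD[OF \<open>mono e\<close>] by (metis (mono_tags) lessThan_iff linorder_not_less mem_Collect_eq order_trans subsetI)
      from card_mono[OF _ this] n show False by simp
    qed
  qed
  then have "{c. n < (\<Sum>\<mu> | is_eigenvalue T \<mu> \<and> \<mu> \<le> c. eigenvalue_mult T \<mu>)} = {e n..}"
    unfolding count by auto
  then show ?thesis unfolding nth_eigenvalue_def by simp
qed

definition spectral_gap :: "(real \<Rightarrow> real) \<Rightarrow> real \<Rightarrow> real" where
  "spectral_gap v L =
     nth_eigenvalue (dirichlet_schroedinger v L) 1 - nth_eigenvalue (dirichlet_schroedinger v L) 0"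

definition inverse_square_potential :: "real \<Rightarrow> real" where
  "inverse_square_potential x = indicator {1..} x / x\<^sup>2"

end

theory Submission
  imports Defs
begin

text \<open>
  Write \<open>M = L / 2\<close>. A second eigenfunction has a zero \<open>z\<close> inside \<open>(-M, M)\<close>. If \<open>z\<close> lies well to the
  left of \<open>0\<close>, the eigenvalue is at least that of the free problem on \<open>(-M, z)\<close>; otherwise the bound
  \<open>v \<ge> 1 / M\<^sup>2\<close> on \<open>[1, M]\<close> raises the eigenvalue of the problem on \<open>(z, M)\<close>. In both cases it
  exceeds \<open>10 / M\<^sup>2\<close>, while the ground state energy is below \<open>\<pi>\<^sup>2 / M\<^sup>2 < 10 / M\<^sup>2\<close>.
  The upper bounds come from shooting from \<open>M\<close>: with energy \<open>k\<^sup>2\<close>, the value at \<open>-M\<close> of the solution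
  that vanishes at \<open>M\<close> is non-negative at \<open>k = \<pi> / (2 M)\<close>, negative at \<open>k = \<pi> / M\<close> and non-negative
  for some \<open>k\<close> in \<open>(\<pi> / M, 2 \<pi> / M]\<close>.
\<close>

section \<open>Explicit solutions on the half line\<close>

text \<open>Nonnegativity of the potential alone cannot give the lower bound: the second free
  eigenvalue on \<open>(-M, M)\<close> is exactly \<open>pi\<^sup>2 / M\<^sup>2\<close>, with its
  zero at 0, and this is also the bound available for the ground state. The critical configuration
  is thus a zero near 0, where either half has free energy \<open>pi\<^sup>2 / M\<^sup>2\<close>.
  There the tail of the potential decides: although it decays, it is at least
  \<open>1 / M\<^sup>2\<close> on \<open>[1, M]\<close>, the same order as the gap sought, and lifts
  the right half to about \<open>(pi\<^sup>2 + 1) / M\<^sup>2\<close>. The threshold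
  \<open>10 / M\<^sup>2\<close> is a round number between these two values; it leaves room for zeros
  slightly to the left of 0. Eigenvalues are not treated by a variational principle but as squares
  of the zeros, in \<open>k\<close>, of one explicit function. The Bessel formulas on
  \<open>x \<ge> 1\<close> make its continuity in \<open>k\<close> evident, so existence of
  eigenvalues is a matter of signs, and zero spacing shows that none is missed below the
  threshold.\<close>

text \<open>
  \<open>bfun c t\<close> is the hypergeometric series \<open>0F1(; c; -t/4)\<close>. If \<open>s (s - 1) = 1\<close>, the functions
  \<open>x\<^sup>s bfun (s + 1/2) (k\<^sup>2 x\<^sup>2)\<close> solve \<open>u'' = (1 / x\<^sup>2 - k\<^sup>2) u\<close>; they are Bessel functions times
  \<open>sqrt x\<close>, up to normalisation.
\<close>

definition bcoef :: "real \<Rightarrow> nat \<Rightarrow> real" where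
  "bcoef c n = (-1/4) ^ n / (fact n * pochhammer c n)"

definition bfun :: "real \<Rightarrow> real \<Rightarrow> real" where
  "bfun c t = (\<Sum>n. bcoef c n * t ^ n)"

definition bfun' :: "real \<Rightarrow> real \<Rightarrow> real" where
  "bfun' c t = (\<Sum>n. diffs (bcoef c) n * t ^ n)"

definition bfun'' :: "real \<Rightarrow> real \<Rightarrow> real" where
  "bfun'' c t = (\<Sum>n. diffs (diffs (bcoef c)) n * t ^ n)"

lemma bcoef_Suc:
  assumes "\<And>n::nat. c + real n \<noteq> 0"
  shows "4 * (real n + c) * (real n + 1) * bcoef c (Suc n) = - bcoef c n"
proof -
  have "pochhammer c n \<noteq> 0"
    using assms by (auto simp: pochhammer_eq_0_iff) (metis add.right_inverse)
  with assms[of n] show ?thesis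
    by (simp add: bcoef_def pochhammer_Suc divide_simps) (simp add: algebra_simps)
qed

lemma summable_bcoef:
  assumes "\<And>n::nat. c + real n \<noteq> 0"
  shows "summable (\<lambda>n. bcoef c n * t ^ n)"
proof -
  obtain N :: nat where N: "real N \<ge> \<bar>c\<bar> + \<bar>t\<bar> + 1" using real_arch_simple by blast
  show ?thesis
  proof (rule summable_ratio_test[of "1/2" N])
    fix n assume "n \<ge> N"
    then have n: "real n + c \<ge> 1 + \<bar>t\<bar>" using N by (simp add: abs_if split: if_splits)
    have "2 * \<bar>t\<bar> \<le> 4 * (real n + c) * (real n + 1)"
    proof -
      have "4 * (1 + \<bar>t\<bar>) * 1 \<le> 4 * (real n + c) * (real n + 1)"
        using n by (intro mult_mono) auto
      then show ?thesis by simp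
    qed
    then have "2 * \<bar>t\<bar> * \<bar>bcoef c (Suc n)\<bar> \<le> \<bar>4 * (real n + c) * (real n + 1) * bcoef c (Suc n)\<bar>"
      unfolding abs_mult[of _ "bcoef c (Suc n)"] by (intro mult_right_mono) auto
    also have "\<dots> = \<bar>bcoef c n\<bar>" using bcoef_Suc[OF assms] by simp
    finally have "2 * \<bar>t\<bar> * \<bar>bcoef c (Suc n)\<bar> * \<bar>t\<bar> ^ n \<le> \<bar>bcoef c n\<bar> * \<bar>t\<bar> ^ n"
      by (rule mult_right_mono) simp
    then show "norm (bcoef c (Suc n) * t ^ Suc n) \<le> 1 / 2 * norm (bcoef c n * t ^ n)"
      by (simp add: abs_mult power_abs algebra_simps)
  qed simp
qed

text \<open>The series is entire, so it may be differentiated termwise everywhere. The coefficient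
  of \<open>t ^ n\<close> in the differential equation is then
  \<open>4 (n + c) (n + 1) b_(n+1) + b_n\<close>, which is zero by \<open>bcoef_Suc\<close>.\<close>

lemma
  assumes c: "\<And>n::nat. c + real n \<noteq> 0"
  shows bfun_has_derivative: "(bfun c has_real_derivative bfun' c t) (at t)"
    and bfun'_has_derivative: "(bfun' c has_real_derivative bfun'' c t) (at t)"
    and bfun_ode: "4 * t * bfun'' c t + 4 * c * bfun' c t + bfun c t = 0"
proof -
  note s0 = summable_bcoef[OF c]
  have s1: "summable (\<lambda>n. diffs (bcoef c) n * t ^ n)" for t
    using s0 by (rule termdiff_converges_all)
  have s2: "summable (\<lambda>n. diffs (diffs (bcoef c)) n * t ^ n)" for t
    using s1 by (rule termdiff_converges_all)
  show "(bfun c has_real_derivative bfun' c t) (at t)"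
    unfolding bfun_def[abs_def] bfun'_def by (rule termdiffs_strong_converges_everywhere[OF s0])
  show "(bfun' c has_real_derivative bfun'' c t) (at t)"
    unfolding bfun'_def[abs_def] bfun''_def by (rule termdiffs_strong_converges_everywhere[OF s1])
  have "(\<lambda>n. t * (real n * diffs (bcoef c) n * t ^ (n - Suc 0))) sums (t * bfun'' c t)"
    unfolding bfun''_def by (intro sums_mult diffs_equiv s2)
  moreover have "t * (real n * diffs (bcoef c) n * t ^ (n - Suc 0)) = real n * diffs (bcoef c) n * t ^ n" for n
    by (cases n) auto
  ultimately have t2: "(\<lambda>n. real n * diffs (bcoef c) n * t ^ n) sums (t * bfun'' c t)" by simp
  have "(\<lambda>n. 4 * (real n * diffs (bcoef c) n * t ^ n) + 4 * c * (diffs (bcoef c) n * t ^ n)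
          + bcoef c n * t ^ n) sums (4 * (t * bfun'' c t) + 4 * c * bfun' c t + bfun c t)"
    using s1 s0 unfolding bfun'_def bfun_def
    by (intro sums_add sums_mult t2 summable_sums)
  moreover have "4 * (real n * diffs (bcoef c) n * t ^ n) + 4 * c * (diffs (bcoef c) n * t ^ n)
      + bcoef c n * t ^ n = 0" for n
  proof -
    have "4 * (real n * diffs (bcoef c) n * t ^ n) + 4 * c * (diffs (bcoef c) n * t ^ n)
      + bcoef c n * t ^ n = (4 * (real n + c) * (real n + 1) * bcoef c (Suc n) + bcoef c n) * t ^ n"
      by (simp add: diffs_def algebra_simps)
    then show ?thesis using bcoef_Suc[OF c, of n] by simp
  qed
  ultimately have "(\<lambda>n. 0) sums (4 * (t * bfun'' c t) + 4 * c * bfun' c t + bfun c t)" by simp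
  then show "4 * t * bfun'' c t + 4 * c * bfun' c t + bfun c t = 0"
    using sums_unique2[OF sums_zero] by (simp add: mult.assoc)
qed

lemma bfun_0: "bfun c 0 = 1"
  unfolding bfun_def powser_zero by (simp add: bcoef_def)

definition fsol :: "real \<Rightarrow> real \<Rightarrow> real \<Rightarrow> real" where
  "fsol s k x = x powr s * bfun (s + 1/2) (k\<^sup>2 * x\<^sup>2)"

definition fsol' :: "real \<Rightarrow> real \<Rightarrow> real \<Rightarrow> real" where
  "fsol' s k x = x powr s * (s / x * bfun (s + 1/2) (k\<^sup>2 * x\<^sup>2) + 2 * k\<^sup>2 * x * bfun' (s + 1/2) (k\<^sup>2 * x\<^sup>2))"

text \<open>With \<open>t = k\<^sup>2 x\<^sup>2\<close>, the second derivative collects into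
  \<open>s (s - 1) / x\<^sup>2\<close> times F plus \<open>k\<^sup>2\<close> times
  \<open>(4 s + 2) F' + 4 t F''\<close>. The choice \<open>c = s + 1/2\<close> makes the last
  bracket equal to \<open>- F\<close>.\<close>

lemma
  assumes c: "\<And>n::nat. s + 1/2 + real n \<noteq> 0" and s: "s * (s - 1) = 1" and x: "x > 0"
  shows fsol_has_derivative: "(fsol s k has_real_derivative fsol' s k x) (at x)"
    and fsol'_has_derivative: "(fsol' s k has_real_derivative (1 / x\<^sup>2 - k\<^sup>2) * fsol s k x) (at x)"
proof -
  let ?c = "s + 1/2"
  note d = DERIV_chain2[OF bfun_has_derivative[OF c]] DERIV_chain2[OF bfun'_has_derivative[OF c]]
  show "(fsol s k has_real_derivative fsol' s k x) (at x)"
    unfolding fsol_def[abs_def] fsol'_def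
    by (rule derivative_eq_intros d refl x)+ (use x in \<open>simp add: field_simps powr_diff\<close>)
  let ?t = "k\<^sup>2 * x\<^sup>2"
  let ?F = "bfun ?c ?t" let ?G = "bfun' ?c ?t" let ?H = "bfun'' ?c ?t"
  have D: "(fsol' s k has_real_derivative
      x powr s * s / x * (s / x * ?F + 2 * k\<^sup>2 * x * ?G) +
      x powr s * (- s / x\<^sup>2 * ?F + s / x * (?G * (2 * k\<^sup>2 * x)) + (2 * k\<^sup>2 * ?G + 2 * k\<^sup>2 * x * (?H * (2 * k\<^sup>2 * x))))) (at x)"
  proof -
    have 1: "((\<lambda>x. s / x) has_real_derivative - s / x\<^sup>2) (at x)"
      by (rule derivative_eq_intros refl)+ (use x in \<open>simp_all add: power2_eq_square\<close>)
    have 2: "((\<lambda>x. k\<^sup>2 * x\<^sup>2) has_real_derivative 2 * k\<^sup>2 * x) (at x)"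
      by (rule derivative_eq_intros refl)+ simp
    have 3: "((\<lambda>x. x powr s) has_real_derivative x powr s * s / x) (at x)"
      by (rule derivative_eq_intros refl x)+ (use x in \<open>simp add: powr_diff\<close>)
    show ?thesis
      unfolding fsol'_def[abs_def]
      by (rule derivative_eq_intros d 1 2 3 refl)+ (simp add: algebra_simps)
  qed
  have ode: "4 * ?t * ?H = - 4 * ?c * ?G - ?F" using bfun_ode[OF c, of ?t] by linarith
  have "x powr s * s / x * (s / x * ?F + 2 * k\<^sup>2 * x * ?G) +
      x powr s * (- s / x\<^sup>2 * ?F + s / x * (?G * (2 * k\<^sup>2 * x)) + (2 * k\<^sup>2 * ?G + 2 * k\<^sup>2 * x * (?H * (2 * k\<^sup>2 * x))))
     = x powr s * (s * (s - 1) / x\<^sup>2 * ?F + k\<^sup>2 * ((4 * s + 2) * ?G + 4 * ?t * ?H))"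
    using x by (simp add: field_simps power2_eq_square)
  also have "\<dots> = (1 / x\<^sup>2 - k\<^sup>2) * fsol s k x"
    unfolding ode s fsol_def by (simp add: algebra_simps)
  finally show "(fsol' s k has_real_derivative (1 / x\<^sup>2 - k\<^sup>2) * fsol s k x) (at x)" using D by simp
qed

lemma
  assumes c: "\<And>n::nat. s + 1/2 + real n \<noteq> 0"
  shows continuous_on_fsol: "continuous_on A (\<lambda>k. fsol s k x)"
    and continuous_on_fsol': "continuous_on A (\<lambda>k. fsol' s k x)"
proof -
  have b: "isCont (bfun (s + 1/2)) t" "isCont (bfun' (s + 1/2)) t" for t
    using bfun_has_derivative[OF c] bfun'_has_derivative[OF c] DERIV_isCont by blast+
  show "continuous_on A (\<lambda>k. fsol s k x)" "continuous_on A (\<lambda>k. fsol' s k x)"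
    unfolding fsol_def fsol'_def continuous_on_eq_continuous_within
    by (intro ballI continuous_intros continuous_within_compose3[OF b(1)] continuous_within_compose3[OF b(2)])+
qed

text \<open>The condition \<open>s + s' = 1\<close> gives \<open>s (s - 1) = s' (s' - 1)\<close>, so
  both functions belong to the same equation without first-order term and their Wronskian is
  constant. Its value is read off at \<open>t = 0\<close>.\<close>

lemma fsol_wronskian:
  assumes c: "\<And>n::nat. s + 1/2 + real n \<noteq> 0" "\<And>n::nat. s' + 1/2 + real n \<noteq> 0"
    and s: "s + s' = 1" and x: "x > 0"
  shows "fsol s k x * fsol' s' k x - fsol' s k x * fsol s' k x = s' - s"
proof -
  let ?F = "bfun (s + 1/2)" let ?F' = "bfun' (s + 1/2)" let ?F'' = "bfun'' (s + 1/2)"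
  let ?G = "bfun (s' + 1/2)" let ?G' = "bfun' (s' + 1/2)" let ?G'' = "bfun'' (s' + 1/2)"
  \<comment> \<open>The Wronskian expressed in \<open>t = k\<^sup>2 x\<^sup>2\<close>, after the
    factor \<open>x powr s * x powr s' = x\<close> has cancelled against
    \<open>1 / x\<close>.\<close>
  let ?W = "\<lambda>t. (s' - s) * (?F t * ?G t) + 2 * t * (?F t * ?G' t - ?G t * ?F' t)"
  note d = bfun_has_derivative[OF c(1)] bfun'_has_derivative[OF c(1)]
    bfun_has_derivative[OF c(2)] bfun'_has_derivative[OF c(2)]
  have "(?W has_real_derivative 0) (at t)" for t
  proof -
    have o: "2 * t * ?F'' t = - (2 * s + 1) * ?F' t - ?F t / 2" "2 * t * ?G'' t = - (2 * s' + 1) * ?G' t - ?G t / 2"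
      using bfun_ode[OF c(1), of t] bfun_ode[OF c(2), of t] by (auto simp: algebra_simps)
    have s': "s' - s = 1 - 2 * s" "2 * s' + 1 = 3 - 2 * s" using s by simp_all
    have "(?W has_real_derivative (s' - s) * (?F' t * ?G t + ?F t * ?G' t) + 2 * (?F t * ?G' t - ?G t * ?F' t)
      + (?F t * (2 * t * ?G'' t) - ?G t * (2 * t * ?F'' t))) (at t)"
      by (rule derivative_eq_intros d refl)+ (simp add: algebra_simps)
    also have "(s' - s) * (?F' t * ?G t + ?F t * ?G' t) + 2 * (?F t * ?G' t - ?G t * ?F' t)
      + (?F t * (2 * t * ?G'' t) - ?G t * (2 * t * ?F'' t)) = 0"
      unfolding o unfolding s' by (simp add: algebra_simps)
    finally show ?thesis .
  qed
  then have "?W (k\<^sup>2 * x\<^sup>2) = ?W 0" by (intro DERIV_isconst_all) auto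
  then have W: "?W (k\<^sup>2 * x\<^sup>2) = s' - s" by (simp add: bfun_0)
  have p: "x powr s * x powr s' = x" using s x by (simp flip: powr_add)
  have "fsol s k x * fsol' s' k x - fsol' s k x * fsol s' k x = (x powr s * x powr s') / x * ?W (k\<^sup>2 * x\<^sup>2)"
    unfolding fsol_def fsol'_def using x by (simp add: field_simps power2_eq_square)
  then show ?thesis unfolding p W using x by simp
qed

section \<open>Riccati comparison\<close>

text \<open>Real solutions of \<open>u'' = (v - \<mu>) u\<close>; the finite exceptional set allows for jumps of \<open>v\<close>.\<close>

definition schroed_sol ::
    "(real \<Rightarrow> real) \<Rightarrow> real \<Rightarrow> real \<Rightarrow> real \<Rightarrow> (real \<Rightarrow> real) \<Rightarrow> (real \<Rightarrow> real) \<Rightarrow> bool" where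
  "schroed_sol v \<mu> a b u u' \<longleftrightarrow>
     (\<forall>x\<in>{a..b}. (u has_real_derivative u' x) (at x within {a..b})) \<and>
     continuous_on {a..b} u' \<and>
     (\<exists>S. finite S \<and> (\<forall>x\<in>{a<..<b} - S. (u' has_real_derivative (v x - \<mu>) * u x) (at x)))"

lemma schroed_solE:
  assumes "schroed_sol v \<mu> a b u u'"
  obtains S where "finite S" "continuous_on {a..b} u" "continuous_on {a..b} u'"
    "\<And>x. x \<in> {a<..<b} - S \<Longrightarrow> (u has_real_derivative u' x) (at x)"
    "\<And>x. x \<in> {a<..<b} - S \<Longrightarrow> (u' has_real_derivative (v x - \<mu>) * u x) (at x)"
proof -
  obtain S where S: "finite S" "\<forall>x\<in>{a<..<b} - S. (u' has_real_derivative (v x - \<mu>) * u x) (at x)"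
    using assms unfolding schroed_sol_def by blast
  have u: "\<forall>x\<in>{a..b}. (u has_real_derivative u' x) (at x within {a..b})" "continuous_on {a..b} u'"
    using assms unfolding schroed_sol_def by blast+
  have "(u has_real_derivative u' x) (at x)" if "x \<in> {a<..<b} - S" for x
    using bspec[OF u(1), of x] at_within_Icc_at[of a x b] that by simp
  moreover have "continuous_on {a..b} u"
    using u(1) by (meson DERIV_continuous continuous_on_eq_continuous_within)
  ultimately show thesis using S u(2) that by blast
qed

lemma schroed_sol_subset:
  assumes "schroed_sol v \<mu> a b u u'" "a \<le> c" "d \<le> b"
  shows "schroed_sol v \<mu> c d u u'"
proof -
  have sub: "{c..d} \<subseteq> {a..b}" "{c<..<d} \<subseteq> {a<..<b}" using assms by auto
  obtain S where S: "finite S" "\<And>x. x \<in> {a<..<b} - S \<Longrightarrow> (u' has_real_derivative (v x - \<mu>) * u x) (at x)"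
    and u: "\<And>x. x \<in> {a..b} \<Longrightarrow> (u has_real_derivative u' x) (at x within {a..b})" "continuous_on {a..b} u'"
    using assms(1) unfolding schroed_sol_def by blast
  show ?thesis
    unfolding schroed_sol_def
  proof (intro conjI exI[of _ S] ballI)
    show "(u has_real_derivative u' x) (at x within {c..d})" if "x \<in> {c..d}" for x
      by (rule DERIV_subset[OF u(1) sub(1)]) (use that sub in blast)
    show "continuous_on {c..d} u'" by (rule continuous_on_subset[OF u(2) sub(1)])
    show "(u' has_real_derivative (v x - \<mu>) * u x) (at x)" if "x \<in> {c<..<d} - S" for x
      by (rule S(2)) (use that sub in blast)
  qed (rule S(1))
qed

lemma schroed_sol_lincomb:
  assumes "schroed_sol v \<mu> a b u u'" "schroed_sol v \<mu> a b w w'"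
  shows "schroed_sol v \<mu> a b (\<lambda>x. u x - c * w x) (\<lambda>x. u' x - c * w' x)"
proof -
  obtain S T where S: "finite S" "\<forall>x\<in>{a<..<b} - S. (u' has_real_derivative (v x - \<mu>) * u x) (at x)"
    and T: "finite T" "\<forall>x\<in>{a<..<b} - T. (w' has_real_derivative (v x - \<mu>) * w x) (at x)"
    using assms unfolding schroed_sol_def by blast
  show ?thesis
    unfolding schroed_sol_def
  proof (intro conjI exI[of _ "S \<union> T"] ballI)
    show "((\<lambda>x. u' x - c * w' x) has_real_derivative (v x - \<mu>) * (u x - c * w x)) (at x)"
      if "x \<in> {a<..<b} - (S \<union> T)" for x
    proof -
      have "((\<lambda>x. u' x - c * w' x) has_real_derivative (v x - \<mu>) * u x - c * ((v x - \<mu>) * w x)) (at x)"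
        using S(2) T(2) that by (intro DERIV_diff DERIV_cmult) auto
      then show ?thesis by (simp add: algebra_simps)
    qed
  qed (use assms S(1) T(1) in \<open>auto simp: schroed_sol_def intro!: DERIV_diff DERIV_cmult continuous_intros\<close>)
qed

lemma DERIV_nonneg_finite_exceptions:
  fixes f :: "real \<Rightarrow> real"
  assumes "a \<le> b" "finite S" "continuous_on {a..b} f"
    and "\<And>x. x \<in> {a<..<b} - S \<Longrightarrow> (f has_real_derivative f' x) (at x)"
    and "\<And>x. x \<in> {a<..<b} - S \<Longrightarrow> 0 \<le> f' x"
  shows "f a \<le> f b"
proof -
  let ?g = "\<lambda>x. if x \<in> {a<..<b} - S then f' x else 0"
  have "(?g has_integral f b - f a) {a..b}"
    using assms by (intro fundamental_theorem_of_calculus_interior_strong[of S])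
      (auto simp flip: has_real_derivative_iff_has_vector_derivative)
  then have "0 \<le> f b - f a" by (rule has_integral_nonneg) (use assms in auto)
  then show ?thesis by simp
qed

text \<open>
  If \<open>r' + r\<^sup>2 \<le> v - \<mu>\<close>, then \<open>u u' - r u\<^sup>2\<close> has a derivative of at least \<open>(u' - r u)\<^sup>2\<close>. Here \<open>r\<close> is
  the logarithmic derivative of a positive supersolution.
\<close>

lemma
  assumes sol: "schroed_sol v \<mu> p q u u'" and "p < q"
    and r: "continuous_on {p..q} r" "\<And>x. x \<in> {p<..<q} \<Longrightarrow> (r has_real_derivative r' x) (at x)"
    and ric: "\<And>x. x \<in> {p<..<q} \<Longrightarrow> r' x + (r x)\<^sup>2 \<le> v x - \<mu>"
  shows riccati_mono: "u p * u' p - r p * (u p)\<^sup>2 \<le> u q * u' q - r q * (u q)\<^sup>2"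
    and riccati_mono_eq: "u p * u' p - r p * (u p)\<^sup>2 = u q * u' q - r q * (u q)\<^sup>2 \<Longrightarrow> u' q = r q * u q"
proof -
  obtain S where S: "finite S" and c: "continuous_on {p..q} u" "continuous_on {p..q} u'"
    and d: "\<And>x. x \<in> {p<..<q} - S \<Longrightarrow> (u has_real_derivative u' x) (at x)"
    "\<And>x. x \<in> {p<..<q} - S \<Longrightarrow> (u' has_real_derivative (v x - \<mu>) * u x) (at x)"
    using schroed_solE[OF sol] by metis
  let ?h = "\<lambda>x. u x * u' x - r x * (u x)\<^sup>2"
  let ?g = "\<lambda>x. (u' x - r x * u x)\<^sup>2"
  \<comment> \<open>At the exceptional points and the ends the value is set to \<open>?g\<close>, so
    that \<open>?g \<le> ?h'\<close> holds on the whole interval.\<close>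
  let ?h' = "\<lambda>x. if x \<in> {p<..<q} - S then ?g x + (v x - \<mu> - (r' x + (r x)\<^sup>2)) * (u x)\<^sup>2 else ?g x"
  have "(?h has_real_derivative ?h' x) (at x)" if x: "x \<in> {p<..<q} - S" for x
  proof -
    have "(r has_real_derivative r' x) (at x)" using r(2) x by simp
    with d[OF x] have "(?h has_real_derivative u' x * u' x + (v x - \<mu>) * u x * u x
        - (r' x * (u x)\<^sup>2 + (of_nat 2 * (u' x * u x ^ (2 - Suc 0))) * r x)) (at x)"
      by (intro DERIV_diff DERIV_mult DERIV_power)
    also have "u' x * u' x + (v x - \<mu>) * u x * u x
        - (r' x * (u x)\<^sup>2 + (of_nat 2 * (u' x * u x ^ (2 - Suc 0))) * r x) = ?h' x"
      using x by (simp add: power2_eq_square algebra_simps)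
    finally show ?thesis .
  qed
  then have h: "(?h' has_integral ?h q - ?h p) {p..q}"
    using S c r(1) \<open>p < q\<close>
    by (intro fundamental_theorem_of_calculus_interior_strong[of S])
      (auto simp flip: has_real_derivative_iff_has_vector_derivative intro!: continuous_intros)
  have cg: "continuous_on {p..q} ?g" using c r(1) by (intro continuous_intros)
  then have g: "(?g has_integral integral {p..q} ?g) {p..q}"
    by (intro integrable_integral integrable_continuous_interval)
  have le: "integral {p..q} ?g \<le> ?h q - ?h p"
    by (rule has_integral_le[OF g h]) (use ric in auto)
  have ge: "0 \<le> integral {p..q} ?g" by (rule has_integral_nonneg[OF g]) simp
  show "?h p \<le> ?h q" using le ge by simp
  show "u' q = r q * u q" if "?h p = ?h q"
  proof -
    \<comment> \<open>A continuous nonnegative function with zero integral vanishes everywhere, in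
      particular at the end point \<open>q\<close>.\<close>
    have "integral {p..q} ?g = 0" using le ge that by simp
    then have "?g q = 0" using integral_eq_0_iff[OF cg \<open>p < q\<close>] \<open>p < q\<close> by simp
    then show ?thesis by simp
  qed
qed

text \<open>Gronwall argument: the energy \<open>E = u\<^sup>2 + u'\<^sup>2\<close> satisfies
  \<open>\<bar>E'\<bar> \<le> (1 + B) E\<close>, so a zero of \<open>E\<close> spreads to the left
  by the weight \<open>exp (K x)\<close> and to the right by \<open>exp (- K x)\<close>.\<close>

lemma schroed_sol_unique:
  assumes sol: "schroed_sol v \<mu> a b u u'" and B: "\<And>x. x \<in> {a..b} \<Longrightarrow> \<bar>v x - \<mu>\<bar> \<le> B"
    and z: "z \<in> {a..b}" "u z = 0" "u' z = 0" and x: "x \<in> {a..b}"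
  shows "u x = 0" "u' x = 0"
proof -
  obtain S where S: "finite S" and c: "continuous_on {a..b} u" "continuous_on {a..b} u'"
    and d: "\<And>x. x \<in> {a<..<b} - S \<Longrightarrow> (u has_real_derivative u' x) (at x)"
    "\<And>x. x \<in> {a<..<b} - S \<Longrightarrow> (u' has_real_derivative (v x - \<mu>) * u x) (at x)"
    using schroed_solE[OF sol] by metis
  define K where "K = 1 + B"
  let ?E = "\<lambda>x. (u x)\<^sup>2 + (u' x)\<^sup>2"
  let ?D = "\<lambda>x. 2 * (u x * u' x) * (1 + (v x - \<mu>))"
  have D: "(?E has_real_derivative ?D x) (at x)" if "x \<in> {a<..<b} - S" for x
    by (rule derivative_eq_intros d[OF that] refl)+ (simp add: algebra_simps)
  have bd: "\<bar>?D x\<bar> \<le> K * ?E x" if "x \<in> {a..b}" for x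
  proof -
    have "\<bar>2 * (u x * u' x)\<bar> \<le> ?E x"
      using sum_squares_bound[of "u x" "u' x"] sum_squares_bound[of "u x" "- u' x"] by (auto simp: abs_if)
    moreover have "\<bar>1 + (v x - \<mu>)\<bar> \<le> K" using B[OF that] unfolding K_def by linarith
    ultimately show ?thesis unfolding abs_mult[of _ "1 + (v x - \<mu>)"]
      by (subst mult.commute[of K]) (intro mult_mono, auto)
  qed
  have E: "?E z = 0" using z by simp
  have "?E x \<le> 0"
  proof (cases "x \<le> z")
    case True
    have "?E x * exp (K * x) \<le> ?E z * exp (K * z)"
    proof (rule DERIV_nonneg_finite_exceptions[OF True S])
      show "continuous_on {x..z} (\<lambda>x. ?E x * exp (K * x))"
        by (intro continuous_intros continuous_on_subset[OF c(1)] continuous_on_subset[OF c(2)]) (use x z in auto)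
      show "((\<lambda>x. ?E x * exp (K * x)) has_real_derivative (?D t + K * ?E t) * exp (K * t)) (at t)"
        if "t \<in> {x<..<z} - S" for t
      proof -
        have "(?E has_real_derivative ?D t) (at t)" using D that x z by auto
        moreover have "((\<lambda>x. exp (K * x)) has_real_derivative K * exp (K * t)) (at t)"
          by (rule derivative_eq_intros refl)+ simp
        ultimately show ?thesis
          by (rule DERIV_mult[THEN DERIV_cong]) (simp add: algebra_simps)
      qed
      show "0 \<le> (?D t + K * ?E t) * exp (K * t)" if "t \<in> {x<..<z} - S" for t
        using bd[of t] that x z by (intro mult_nonneg_nonneg) auto
    qed
    then show ?thesis using E by (simp add: mult_le_0_iff)
  next
    case False
    then have "z \<le> x" by simp
    then have "- ?E z * exp (- K * z) \<le> - ?E x * exp (- K * x)"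
    proof (rule DERIV_nonneg_finite_exceptions[OF _ S])
      show "continuous_on {z..x} (\<lambda>x. - ?E x * exp (- K * x))"
        by (intro continuous_intros continuous_on_subset[OF c(1)] continuous_on_subset[OF c(2)]) (use x z in auto)
      show "((\<lambda>x. - ?E x * exp (- K * x)) has_real_derivative (- ?D t + K * ?E t) * exp (- K * t)) (at t)"
        if "t \<in> {z<..<x} - S" for t
      proof -
        have "((\<lambda>x. - ?E x) has_real_derivative - ?D t) (at t)" using D that x z by (intro DERIV_minus) auto
        moreover have "((\<lambda>x. exp (- K * x)) has_real_derivative - K * exp (- K * t)) (at t)"
          by (rule derivative_eq_intros refl)+ simp
        ultimately show ?thesis
          by (rule DERIV_mult[THEN DERIV_cong]) (simp add: algebra_simps)
      qed
      show "0 \<le> (- ?D t + K * ?E t) * exp (- K * t)" if "t \<in> {z<..<x} - S" for t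
        using bd[of t] that x z by (intro mult_nonneg_nonneg) auto
    qed
    then show ?thesis using E by (simp add: mult_le_0_iff zero_le_mult_iff)
  qed
  then show "u x = 0" "u' x = 0" by (simp_all add: sum_power2_le_zero_iff)
qed

text \<open>This is the logarithmic derivative of \<open>cos (k (x - m))\<close>, a solution of
  \<open>w'' = - k\<^sup>2 w\<close>; hence \<open>r' + r\<^sup>2 = - k\<^sup>2\<close>.\<close>

lemma tan_riccati:
  assumes "cos (k * (x - m)) \<noteq> 0"
  shows "((\<lambda>x. - k * tan (k * (x - m))) has_real_derivative - k\<^sup>2 - (- k * tan (k * (x - m)))\<^sup>2) (at x)"
proof -
  have "((\<lambda>x. - k * tan (k * (x - m))) has_real_derivative - k * (inverse ((cos (k * (x - m)))\<^sup>2) * k)) (at x)"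
    by (rule derivative_eq_intros refl assms)+ simp
  also have "inverse ((cos (k * (x - m)))\<^sup>2) = 1 + (tan (k * (x - m)))\<^sup>2"
    using tan_sec[OF assms] by (simp add: power_inverse)
  finally show ?thesis by (simp add: algebra_simps power2_eq_square)
qed

lemma cos_shift_pos:
  fixes k :: real
  assumes "k > 0" "x \<in> {p..q}" "k * (q - p) < pi"
  shows "cos (k * (x - (p + q) / 2)) > 0"
proof (rule cos_gt_zero_pi)
  have "k * (x - (p + q) / 2) \<le> k * ((q - p) / 2)" "k * (- ((q - p) / 2)) \<le> k * (x - (p + q) / 2)"
    using assms by (intro mult_left_mono; simp add: field_simps)+
  then show "- (pi / 2) < k * (x - (p + q) / 2)" "k * (x - (p + q) / 2) < pi / 2"
    using assms(3) unfolding mult_minus_right times_divide_eq_right by linarith+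
qed

text \<open>Comparison with a half wave of frequency \<open>k\<close> that has no zero in \<open>{p..q}\<close>.\<close>

lemma sturm_zero_spacing:
  assumes sol: "schroed_sol v \<mu> p q u u'" and "p < q" "u p = 0" "u q = 0"
    and k: "k > 0" "k * (q - p) < pi" and v: "\<And>x. x \<in> {p<..<q} \<Longrightarrow> - k\<^sup>2 \<le> v x - \<mu>"
  shows "u' q = 0"
proof -
  let ?m = "(p + q) / 2"
  let ?r = "\<lambda>x. - k * tan (k * (x - ?m))"
  have d: "(?r has_real_derivative - k\<^sup>2 - (?r x)\<^sup>2) (at x)" if "x \<in> {p..q}" for x
    by (rule tan_riccati) (use cos_shift_pos[OF k(1) that k(2)] in simp)
  then have "continuous_on {p..q} ?r"
    by (meson DERIV_isCont continuous_at_imp_continuous_on)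
  \<comment> \<open>Since \<open>u\<close> vanishes at both ends, so does
    \<open>u u' - r u\<^sup>2\<close>, which is the equality case.\<close>
  from riccati_mono_eq[OF sol \<open>p < q\<close> this, of "\<lambda>x. - k\<^sup>2 - (?r x)\<^sup>2"] d v assms(3,4)
  show ?thesis by auto
qed

section \<open>Shooting from the right end point\<close>

abbreviation (input) "V \<equiv> inverse_square_potential"

lemma inverse_square_potential_simps:
  "x < 1 \<Longrightarrow> V x = 0" "1 \<le> x \<Longrightarrow> V x = 1 / x\<^sup>2"
  by (auto simp: inverse_square_potential_def)

lemma inverse_square_potential_bounds: "0 \<le> V x" "V x \<le> 1"
  by (cases "x < 1"; simp add: inverse_square_potential_simps)+

lemma inverse_square_potential_lower:
  assumes "1 \<le> x" "x \<le> M" shows "1 / M\<^sup>2 \<le> V x"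
  using assms by (simp add: inverse_square_potential_simps frac_le power_mono)

lemma V_sol_unique:
  assumes "schroed_sol V \<mu> a b u u'" "z \<in> {a..b}" "u z = 0" "u' z = 0" "x \<in> {a..b}"
  shows "u x = 0" "u' x = 0"
proof -
  have "\<bar>V x - \<mu>\<bar> \<le> 1 + \<bar>\<mu>\<bar>" for x using inverse_square_potential_bounds[of x] by linarith
  then show "u x = 0" "u' x = 0" using schroed_sol_unique[OF assms(1)] assms(2-) by blast+
qed

section \<open>The barrier estimate for zeros that are not far to the left of 0\<close>

lemma le_tan:
  assumes "0 \<le> x" "x < pi / 2" shows "x \<le> tan x"
proof -
  have "0 - tan 0 \<ge> x - tan x"
  proof (rule DERIV_nonpos_imp_nonincreasing[OF assms(1)])
    fix y assume y: "0 \<le> y" "y \<le> x"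
    then have c: "cos y > 0" using assms by (intro cos_gt_zero_pi) auto
    have "((\<lambda>x. x - tan x) has_real_derivative 1 - inverse ((cos y)\<^sup>2)) (at y)"
      by (intro DERIV_diff DERIV_ident DERIV_tan) (use c in simp)
    moreover have "inverse ((cos y)\<^sup>2) = 1 + (tan y)\<^sup>2" using tan_sec[of y] c by (simp add: power_inverse)
    ultimately show "\<exists>d. ((\<lambda>x. x - tan x) has_real_derivative d) (at y) \<and> d \<le> 0"
      by (intro exI[of _ "- (tan y)\<^sup>2"]) auto
  qed
  then show ?thesis by simp
qed

text \<open>
  For \<open>z < 1\<close>, the comparison function is linear on \<open>[z, 1]\<close> and the logarithmic derivative of a wave of
  frequency \<open>3 / M\<close> on \<open>[1, M]\<close>, where \<open>v - \<mu> \<ge> 1 / M\<^sup>2 - 10 / M\<^sup>2\<close>. It may jump down at \<open>1\<close>.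
\<close>

lemma zero_near_barrier_bound:
  assumes sol: "schroed_sol V \<mu> z M u u'" and zeros: "u z = 0" "u M = 0"
    and M: "1500 \<le> M" and z: "- 8 / 1000 * M \<le> z" "z < M" and \<mu>: "\<mu> \<le> 10 / M\<^sup>2"
  shows "u' M = 0"
proof -
  have far: "- (3 / M)\<^sup>2 \<le> V x - \<mu>" if "1 \<le> x" "x \<le> M" for x
    using inverse_square_potential_lower[OF that] \<mu> by (simp add: power_divide)
  show ?thesis
  proof (cases "1 \<le> z")
    case True
    show ?thesis
    proof (rule sturm_zero_spacing[OF sol z(2) zeros, of "3 / M"])
      have "3 / M * (M - z) = 3 - 3 * z / M" using M by (simp add: field_simps)
      moreover have "0 \<le> 3 * z / M" using M True by simp
      ultimately show "3 / M * (M - z) < pi" using pi_gt3 by linarith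
      show "- (3 / M)\<^sup>2 \<le> V x - \<mu>" if "x \<in> {z<..<M}" for x using far that True by simp
    qed (use M in simp)
  next
    case False
    \<comment> \<open>On \<open>[z, 1]\<close> the numerator stays between 25 and
      \<open>26 + 12 = 38\<close>. The slope \<open>- 1500 / M\<^sup>2\<close> outweighs
      \<open>38\<^sup>2 = 1444\<close> by more than the 10 coming from \<open>\<mu>\<close>, and
      \<open>M \<ge> 1500\<close> keeps \<open>rl 1 \<ge> 25 / M\<close>, enough for the matching at
      1.\<close>
    define rl where "rl x = (26 - 1500 * x / M) / M" for x
    have "u z * u' z - rl z * (u z)\<^sup>2 \<le> u 1 * u' 1 - rl 1 * (u 1)\<^sup>2"
    proof (rule riccati_mono)
      show "schroed_sol V \<mu> z 1 u u'" using schroed_sol_subset[OF sol] M by simp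
      show "continuous_on {z..1} rl" unfolding rl_def using M by (intro continuous_intros) auto
      fix x assume x: "x \<in> {z<..<1}"
      show "(rl has_real_derivative - 1500 / M\<^sup>2) (at x)"
      proof -
        have "rl = (\<lambda>x. 26 / M - 1500 / M\<^sup>2 * x)"
          unfolding rl_def by (simp add: diff_divide_distrib power2_eq_square)
        then show ?thesis
          using DERIV_diff[OF DERIV_const DERIV_cmult_Id, of "26 / M" "1500 / M\<^sup>2" x UNIV] by simp
      qed
      have "- 8 / 1000 * M \<le> x" "x \<le> M" using z x M by auto
      then have "1500 * x / M \<ge> - 12" "1500 * x / M \<le> 1500" using M by (auto simp: field_simps)
      moreover have "1500 * x / M \<le> 1"
      proof -
        have "1500 * x \<le> 1500 * 1" using x by simp
        then show ?thesis using M by (simp add: divide_le_eq)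
      qed
      ultimately have "(26 - 1500 * x / M)\<^sup>2 \<le> 38\<^sup>2" by (intro power_mono) auto
      then have "(rl x)\<^sup>2 \<le> 1444 / M\<^sup>2" unfolding rl_def power_divide by (intro divide_right_mono) auto
      then have "- 1500 / M\<^sup>2 + (rl x)\<^sup>2 \<le> - 56 / M\<^sup>2" by (simp add: field_simps)
      also have "\<dots> \<le> V x - 10 / M\<^sup>2"
      proof -
        have "- 56 / M\<^sup>2 \<le> - 10 / M\<^sup>2" by (intro divide_right_mono) auto
        then show ?thesis using inverse_square_potential_bounds(1)[of x] by linarith
      qed
      finally show "- 1500 / M\<^sup>2 + (rl x)\<^sup>2 \<le> V x - \<mu>" using \<mu> by linarith
    qed (use False in simp)
    then have h1: "rl 1 * (u 1)\<^sup>2 \<le> u 1 * u' 1" using zeros by simp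
    \<comment> \<open>The phase \<open>3 / M * (x - m)\<close> runs from -1.431 at 0 to 1.569 at
      \<open>M\<close>. Its right end is placed just below \<open>pi / 2\<close>, so that its left
      end stays clear of \<open>- pi / 2\<close> and \<open>rr 1\<close> remains moderate.\<close>
    define m where "m = 477 / 1000 * M"
    define rr where "rr x = - (3 / M) * tan (3 / M * (x - m))" for x
    have cpos: "cos (3 / M * (x - m)) > 0" if "x \<in> {1..M}" for x
    proof (rule cos_gt_zero_pi)
      have pi2: "157 / 100 < pi / 2" using pi_approx by simp
      have "3 / M * (x - m) \<le> 3 / M * (M - m)" "3 / M * (0 - m) \<le> 3 / M * (x - m)"
        using that M by (intro mult_left_mono; simp)+
      moreover have "3 / M * (M - m) = 1569 / 1000" "3 / M * (0 - m) = - 1431 / 1000"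
        using M by (simp_all add: m_def)
      ultimately have "3 / M * (x - m) \<le> 1569 / 1000" "- 1431 / 1000 \<le> 3 / M * (x - m)" by linarith+
      then show "- (pi / 2) < 3 / M * (x - m)" "3 / M * (x - m) < pi / 2"
        using pi2 by linarith+
    qed
    have d: "(rr has_real_derivative - (3 / M)\<^sup>2 - (rr x)\<^sup>2) (at x)" if "x \<in> {1..M}" for x
      unfolding rr_def[abs_def] by (rule tan_riccati) (use cpos[OF that] in simp)
    have cr: "continuous_on {1..M} rr"
      using d DERIV_isCont by (blast intro: continuous_at_imp_continuous_on)
    have s1: "schroed_sol V \<mu> 1 M u u'" using schroed_sol_subset[OF sol] False by simp
    have ric: "- (3 / M)\<^sup>2 - (rr x)\<^sup>2 + (rr x)\<^sup>2 \<le> V x - \<mu>" if "x \<in> {1<..<M}" for x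
      using far that by simp
    have "1 < M" using M by simp
    note ar = s1 this cr d[OF subsetD[OF greaterThanLessThan_subseteq_atLeastAtMost_iff[THEN iffD2]]] ric
    have "rr 1 \<le> 25 / M"
    proof -
      \<comment> \<open>The complementary angle:
        \<open>tan (pi / 2 - y) = 1 / tan y \<le> 1 / y\<close>, with
        \<open>y \<ge> 1.57 - 1.431 = 0.139\<close>.\<close>
      define y where "y = pi / 2 - 3 / M * (m - 1)"
      have "3 / M * (m - 1) = 1431 / 1000 - 3 / M" using M by (simp add: m_def field_simps)
      moreover have "0 < 3 / M" "3 / M \<le> 3 / 1500" using M by (simp, intro divide_left_mono) auto
      moreover have "157 / 100 < pi / 2" using pi_approx by simp
      ultimately have y: "139 / 1000 \<le> y" "y < pi / 2" unfolding y_def by linarith+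
      have "139 / 1000 \<le> tan y" using le_tan[of y] y by linarith
      then have "1 / tan y \<le> 1 / (139 / 1000)" by (intro divide_left_mono) auto
      moreover have "rr 1 = 3 / M * tan (3 / M * (m - 1))"
      proof -
        have "3 / M * (1 - m) = - (3 / M * (m - 1))" using M by (simp add: field_simps)
        then show ?thesis unfolding rr_def by (simp only: tan_minus mult_minus_left mult_minus_right minus_minus)
      qed
      moreover have "tan (3 / M * (m - 1)) = 1 / tan y" unfolding y_def tan_inverse by simp
      ultimately have "rr 1 \<le> 3 / M * (1 / (139 / 1000))" using M by (simp only:, intro mult_left_mono) auto
      also have "\<dots> \<le> 25 / M" using M by (simp add: field_simps)
      finally show ?thesis .
    qed
    moreover have "25 / M \<le> rl 1"
    proof -
      have "1500 * 1 / M \<le> 1" using M by simp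
      then show ?thesis unfolding rl_def using M by (intro divide_right_mono) auto
    qed
    ultimately have "rr 1 \<le> rl 1" by simp
    \<comment> \<open>Passing from \<open>rl\<close> to the smaller \<open>rr\<close> at 1 can only
      increase \<open>u u' - r u\<^sup>2\<close>. It is therefore nonnegative at 1, nondecreasing
      and zero at \<open>M\<close>, which forces equality.\<close>
    then have "rr 1 * (u 1)\<^sup>2 \<le> rl 1 * (u 1)\<^sup>2" by (intro mult_right_mono) auto
    with h1 have h2: "0 \<le> u 1 * u' 1 - rr 1 * (u 1)\<^sup>2" by simp
    have "u 1 * u' 1 - rr 1 * (u 1)\<^sup>2 \<le> u M * u' M - rr M * (u M)\<^sup>2"
      by (rule riccati_mono[OF ar]) simp_all
    with h2 zeros have "u 1 * u' 1 - rr 1 * (u 1)\<^sup>2 = u M * u' M - rr M * (u M)\<^sup>2" by simp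
    then have "u' M = rr M * u M" by (intro riccati_mono_eq[OF ar]) simp_all
    with zeros show ?thesis by simp
  qed
qed

section \<open>The solution through both regions, matched at \<open>x = 1\<close>\<close>

definition s_plus :: real where "s_plus = (1 + sqrt 5) / 2"
definition s_minus :: real where "s_minus = (1 - sqrt 5) / 2"

lemma s_plus_eq: "s_plus * (s_plus - 1) = 1" and s_minus_eq: "s_minus * (s_minus - 1) = 1"
  by (simp_all add: s_plus_def s_minus_def field_simps)

lemma s_plus_nonres: "s_plus + 1 / 2 + real n \<noteq> 0"
proof -
  have "0 < s_plus + 1 / 2 + real n" unfolding s_plus_def by (simp add: add_pos_nonneg)
  then show ?thesis by simp
qed

text \<open>The coefficients of \<open>bfun (s_minus + 1/2)\<close> divide by Pochhammer symbols,
  which must not vanish. A vanishing factor would make \<open>sqrt 5\<close> an even integer, hence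
  5 an even square.\<close>

lemma s_minus_nonres: "s_minus + 1 / 2 + real n \<noteq> 0"
proof
  assume "s_minus + 1 / 2 + real n = 0"
  then have "sqrt 5 = 2 * real n + 2" unfolding s_minus_def by (simp add: field_simps)
  then have "(sqrt 5)\<^sup>2 = (2 * real n + 2)\<^sup>2" by simp
  then have "(2 * real n + 2)\<^sup>2 = 5" by simp
  then have "real ((2 * n + 2)\<^sup>2) = real 5"
    unfolding of_nat_power of_nat_add of_nat_mult by simp
  then have "(2 * n + 2)\<^sup>2 = 5" unfolding of_nat_eq_iff .
  moreover have "even ((2 * n + 2)\<^sup>2)" by simp
  ultimately have "even (5 :: nat)" by simp
  then show False by simp
qed

text \<open>The solution on \<open>x \<ge> 1\<close> that vanishes at \<open>M\<close>.\<close>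

definition rsol :: "real \<Rightarrow> real \<Rightarrow> real \<Rightarrow> real" where
  "rsol M k x = fsol s_minus k x * fsol s_plus k M - fsol s_plus k x * fsol s_minus k M"

definition rsol' :: "real \<Rightarrow> real \<Rightarrow> real \<Rightarrow> real" where
  "rsol' M k x = fsol' s_minus k x * fsol s_plus k M - fsol' s_plus k x * fsol s_minus k M"

text \<open>The free wave that continues \<open>rsol\<close> to the left of 1, where the potential
  is zero, with the same value and slope at 1.\<close>

definition lsol :: "real \<Rightarrow> real \<Rightarrow> real \<Rightarrow> real" where
  "lsol M k x = rsol M k 1 * cos (k * (x - 1)) + rsol' M k 1 / k * sin (k * (x - 1))"

definition lsol' :: "real \<Rightarrow> real \<Rightarrow> real \<Rightarrow> real" where
  "lsol' M k x = rsol' M k 1 * cos (k * (x - 1)) - rsol M k 1 * k * sin (k * (x - 1))"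

definition shoot :: "real \<Rightarrow> real \<Rightarrow> real \<Rightarrow> real" where
  "shoot M k x = (if x \<le> 1 then lsol M k x else rsol M k x)"

definition shoot' :: "real \<Rightarrow> real \<Rightarrow> real \<Rightarrow> real" where
  "shoot' M k x = (if x \<le> 1 then lsol' M k x else rsol' M k x)"

lemma has_real_derivative_piecewise:
  assumes l: "\<And>x. x \<le> c \<Longrightarrow> (l has_real_derivative l' x) (at x)"
    and r: "\<And>x. c \<le> x \<Longrightarrow> (r has_real_derivative r' x) (at x)"
    and eq: "l c = r c" "l' c = r' c"
  shows "((\<lambda>x. if x \<le> c then l x else r x) has_real_derivative (if x \<le> c then l' x else r' x)) (at x)"
    (is "(?f has_real_derivative _) _")
proof -
  consider "x < c" | "x > c" | "x = c" by linarith
  then show ?thesis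
  proof cases
    case 1
    then have "\<forall>\<^sub>F y in nhds x. ?f y = l y"
      using eventually_nhds_in_open[of "{..<c}" x] by (auto elim: eventually_mono)
    with 1 l[of x] show ?thesis by (subst DERIV_cong_ev[OF refl _ refl]) auto
  next
    case 2
    then have "\<forall>\<^sub>F y in nhds x. ?f y = r y"
      using eventually_nhds_in_open[of "{c<..}" x] by (auto elim: eventually_mono)
    with 2 r[of x] show ?thesis by (subst DERIV_cong_ev[OF refl _ refl]) auto
  next
    case 3
    have "(?f has_real_derivative l' c) (at c within {..c})"
      by (rule has_field_derivative_transform_within[OF has_field_derivative_at_within[OF l] zero_less_one]) auto
    moreover have "(?f has_real_derivative l' c) (at c within {c..})"
      unfolding eq
      by (rule has_field_derivative_transform_within[OF has_field_derivative_at_within[OF r] zero_less_one])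
        (auto simp: eq)
    ultimately have "(?f has_real_derivative l' c) (at c within {..c} \<union> {c..})"
      unfolding has_field_derivative_iff by (rule Lim_Un)
    moreover have "{..c} \<union> {c..} = UNIV" by auto
    ultimately have "(?f has_real_derivative l' c) (at c)" by simp
    with 3 show ?thesis by simp
  qed
qed

lemma lsol_has_derivative:
  assumes "k > 0"
  shows "(lsol M k has_real_derivative lsol' M k x) (at x)"
    and "(lsol' M k has_real_derivative - k\<^sup>2 * lsol M k x) (at x)"
proof -
  have c: "((\<lambda>x. cos (k * (x - 1))) has_real_derivative - k * sin (k * (x - 1))) (at x)"
    and s: "((\<lambda>x. sin (k * (x - 1))) has_real_derivative k * cos (k * (x - 1))) (at x)"
    by ((rule derivative_eq_intros refl)+, simp)+
  show "(lsol M k has_real_derivative lsol' M k x) (at x)"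
    unfolding lsol_def[abs_def] lsol'_def
    by (rule DERIV_cong[OF DERIV_add[OF DERIV_cmult[OF c] DERIV_cmult[OF s]]]) (use assms in simp)
  show "(lsol' M k has_real_derivative - k\<^sup>2 * lsol M k x) (at x)"
    unfolding lsol'_def[abs_def] lsol_def
    by (rule DERIV_cong[OF DERIV_diff[OF DERIV_cmult[OF c] DERIV_cmult[OF s]]])
      (use assms in \<open>simp add: field_simps power2_eq_square\<close>)
qed

lemma rsol_has_derivative:
  assumes "x > 0"
  shows "(rsol M k has_real_derivative rsol' M k x) (at x)"
    and "(rsol' M k has_real_derivative (1 / x\<^sup>2 - k\<^sup>2) * rsol M k x) (at x)"
proof -
  note p = fsol_has_derivative[OF s_plus_nonres s_plus_eq assms] fsol'_has_derivative[OF s_plus_nonres s_plus_eq assms]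
  note m = fsol_has_derivative[OF s_minus_nonres s_minus_eq assms] fsol'_has_derivative[OF s_minus_nonres s_minus_eq assms]
  show "(rsol M k has_real_derivative rsol' M k x) (at x)"
    unfolding rsol_def[abs_def] rsol'_def by (intro DERIV_diff DERIV_cmult_right p m)
  have "(rsol' M k has_real_derivative (1 / x\<^sup>2 - k\<^sup>2) * fsol s_minus k x * fsol s_plus k M -
      (1 / x\<^sup>2 - k\<^sup>2) * fsol s_plus k x * fsol s_minus k M) (at x)"
    unfolding rsol_def rsol'_def[abs_def] by (intro DERIV_diff DERIV_cmult_right p m)
  then show "(rsol' M k has_real_derivative (1 / x\<^sup>2 - k\<^sup>2) * rsol M k x) (at x)"
    by (rule DERIV_cong) (simp add: rsol_def algebra_simps)
qed

lemma shoot_has_derivative: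
  assumes "k > 0" shows "(shoot M k has_real_derivative shoot' M k x) (at x)"
  unfolding shoot_def[abs_def] shoot'_def
  by (rule has_real_derivative_piecewise[OF lsol_has_derivative(1)[OF assms] rsol_has_derivative(1)])
    (simp_all add: lsol_def lsol'_def)

lemma schroed_sol_shoot:
  assumes k: "k > 0" shows "schroed_sol V (k\<^sup>2) a b (shoot M k) (shoot' M k)"
  unfolding schroed_sol_def
\<comment> \<open>The second derivative jumps with the potential at 1, the only exceptional
  point.\<close>
proof (intro conjI exI[of _ "{1}"] ballI)
  show "(shoot M k has_real_derivative shoot' M k x) (at x within {a..b})" for x
    using shoot_has_derivative[OF k] by (rule has_field_derivative_at_within)
  have "continuous_on ({..1} \<union> {1..}) (\<lambda>x. if x \<le> 1 then lsol' M k x else rsol' M k x)"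
  proof (rule continuous_on_cases)
    show "continuous_on {..1} (lsol' M k)"
      using DERIV_isCont[OF lsol_has_derivative(2)[OF k]] by (intro continuous_at_imp_continuous_on) auto
    show "continuous_on {1..} (rsol' M k)"
      using DERIV_isCont[OF rsol_has_derivative(2)] by (intro continuous_at_imp_continuous_on) auto
  qed (auto simp: lsol'_def)
  then show "continuous_on {a..b} (shoot' M k)"
    unfolding shoot'_def[abs_def] by (rule continuous_on_subset) auto
  fix x :: real assume x: "x \<in> {a<..<b} - {1}"
  show "(shoot' M k has_real_derivative (V x - k\<^sup>2) * shoot M k x) (at x)"
  proof (cases "x < 1")
    case True
    then have "\<forall>\<^sub>F y in nhds x. shoot' M k y = lsol' M k y"
      using eventually_nhds_in_open[of "{..<1}" x] by (auto elim!: eventually_mono simp: shoot'_def)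
    with True lsol_has_derivative(2)[OF k] show ?thesis
      by (subst DERIV_cong_ev[OF refl _ refl]) (auto simp: shoot_def inverse_square_potential_simps)
  next
    case False
    then have "x > 1" using x by simp
    then have "\<forall>\<^sub>F y in nhds x. shoot' M k y = rsol' M k y"
      using eventually_nhds_in_open[of "{1<..}" x] by (auto elim!: eventually_mono simp: shoot'_def)
    with \<open>x > 1\<close> rsol_has_derivative(2)[of x] show ?thesis
      by (subst DERIV_cong_ev[OF refl _ refl]) (auto simp: shoot_def inverse_square_potential_simps)
  qed
qed simp

text \<open>The slope at \<open>M\<close> is the Wronskian of the two Bessel-type solutions, hence
  independent of \<open>k\<close> and \<open>M\<close>. So the shooting solution is never trivial
  and is positive just to the left of \<open>M\<close>.\<close>

lemma shoot_end:
  assumes "M > 1" shows "shoot M k M = 0" "shoot' M k M = - sqrt 5"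
proof -
  show "shoot M k M = 0" using assms by (simp add: shoot_def rsol_def)
  have "shoot' M k M = fsol s_plus k M * fsol' s_minus k M - fsol' s_plus k M * fsol s_minus k M"
    using assms by (simp add: shoot'_def rsol'_def)
  also have "\<dots> = s_minus - s_plus"
    by (rule fsol_wronskian) (use assms s_plus_nonres s_minus_nonres in \<open>auto simp: s_minus_def s_plus_def field_simps\<close>)
  finally show "shoot' M k M = - sqrt 5" by (simp add: s_minus_def s_plus_def field_simps)
qed

text \<open>The value is built from entire series in \<open>k\<^sup>2\<close> and trigonometric
  functions; this continuity feeds the intermediate value arguments in \<open>k\<close>. The
  frequency 0 is excluded because \<open>lsol\<close> divides by \<open>k\<close>.\<close>

lemma continuous_on_shoot:
  assumes "x \<le> 1" shows "continuous_on {0<..} (\<lambda>k. shoot M k x)"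
  using assms unfolding shoot_def lsol_def rsol_def rsol'_def
  by (simp, intro continuous_intros continuous_on_fsol continuous_on_fsol' s_plus_nonres s_minus_nonres) auto

text \<open>The wave is re-expanded around 0 instead of 1, so that its phase at \<open>-M\<close> is
  exactly \<open>- k M\<close> and frequencies such as \<open>pi / M\<close> give clean
  values.\<close>

lemma shoot_left:
  assumes "x \<le> 1" "k > 0"
  shows "shoot M k x = shoot M k 0 * cos (k * x) + shoot' M k 0 / k * sin (k * x)"
proof -
  have e: "cos (k * (x - 1)) = cos (k * x) * cos k + sin (k * x) * sin k"
    "sin (k * (x - 1)) = sin (k * x) * cos k - cos (k * x) * sin k"
    by (simp_all add: right_diff_distrib cos_diff sin_diff)
  show ?thesis using assms unfolding shoot_def shoot'_def lsol_def lsol'_def e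
    by (simp add: field_simps)
qed

section \<open>Eigenspaces\<close>

lemma square_integrable_on_bounded:
  fixes f :: "real \<Rightarrow> complex"
  assumes f: "f \<in> borel_measurable borel" and B: "\<And>x. cmod (f x) \<le> B"
  shows "square_integrable_on f {a<..<b}"
proof -
  have m: "f \<in> borel_measurable lebesgue"
    using f by (simp add: measurable_completion)
  have "set_borel_measurable lebesgue {a<..<b} f"
    unfolding set_borel_measurable_def using m by (intro borel_measurable_scaleR borel_measurable_indicator) auto
  moreover have "set_integrable lebesgue {a<..<b} (\<lambda>x. (cmod (f x))\<^sup>2)"
    unfolding set_integrable_def
  proof (rule integrableI_bounded_set_indicator[where B = "B\<^sup>2"])
    show "(\<lambda>x. (cmod (f x))\<^sup>2) \<in> borel_measurable lebesgue" using m by measurable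
    show "emeasure lebesgue {a<..<b} < \<infinity>" by (cases "a \<le> b") auto
    show "AE x in lebesgue. x \<in> {a<..<b} \<longrightarrow> norm ((cmod (f x))\<^sup>2) \<le> B\<^sup>2"
      using B by (intro always_eventually) (auto intro!: power_mono)
  qed auto
  ultimately show ?thesis unfolding square_integrable_on_def by simp
qed

lemma set_integrable_potential_times:
  fixes u :: "real \<Rightarrow> complex"
  assumes v: "v \<in> borel_measurable borel" "\<And>x. \<bar>v x\<bar> \<le> B" and u: "continuous_on {a..b} u"
  shows "set_integrable lebesgue {a..b} (\<lambda>x. complex_of_real (v x - \<mu>) * u x)"
proof -
  have "bounded (u ` {a..b})"
    using u compact_continuous_image compact_imp_bounded by blast
  then obtain C where C: "\<And>x. x \<in> {a..b} \<Longrightarrow> cmod (u x) \<le> C"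
    unfolding bounded_iff by blast
  let ?g = "\<lambda>x. complex_of_real (v x - \<mu>) * (indicator {a..b} x *\<^sub>R u x)"
  have "(\<lambda>x. indicator {a..b} x *\<^sub>R u x) \<in> borel_measurable borel"
    using u by (intro borel_measurable_continuous_on_indicator) auto
  then have "?g \<in> borel_measurable borel" using v(1) by measurable
  then have m: "?g \<in> borel_measurable lebesgue" by (simp add: measurable_completion)
  have "integrable lebesgue (\<lambda>x. indicator {a..b} x *\<^sub>R ?g x)"
  proof (rule integrableI_bounded_set_indicator[OF _ m, where B = "(B + \<bar>\<mu>\<bar>) * C"])
    show "emeasure lebesgue {a..b} < \<infinity>" by (cases "a \<le> b") auto
    have "cmod (?g x) \<le> (B + \<bar>\<mu>\<bar>) * C" if "x \<in> {a..b}" for x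
    proof -
      have "\<bar>v x - \<mu>\<bar> \<le> B + \<bar>\<mu>\<bar>" using v(2)[of x] by linarith
      moreover have "cmod (?g x) = \<bar>v x - \<mu>\<bar> * cmod (u x)"
        using that by (simp only: norm_mult norm_of_real) simp
      ultimately show ?thesis using C[OF that] by (auto intro!: mult_mono)
    qed
    then show "AE x in lebesgue. x \<in> {a..b} \<longrightarrow> norm (?g x) \<le> (B + \<bar>\<mu>\<bar>) * C"
      by (intro always_eventually) blast
  qed auto
  also have "(\<lambda>x. indicator {a..b} x *\<^sub>R ?g x) = (\<lambda>x. indicator {a..b} x *\<^sub>R (complex_of_real (v x - \<mu>) * u x))"
    by (auto simp: fun_eq_iff indicator_def)
  finally show ?thesis unfolding set_integrable_def .
qed

text \<open>The weak second derivative is controlled only on the open interval, while the integrals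
  run over \<open>{a..x}\<close>. The end points form a null set, and measurability survives
  changing a function at two points.\<close>

lemma set_integral_cong_AE_Ioo:
  fixes f g :: "real \<Rightarrow> complex"
  assumes f: "set_borel_measurable lebesgue {a<..<b} f" and g: "set_integrable lebesgue {a..b} g"
    and ae: "AE x in lebesgue. x \<in> {a<..<b} \<longrightarrow> f x = g x" and x: "x \<le> b"
  shows "(LINT t:{a..x}|lebesgue. f t) = (LINT t:{a..x}|lebesgue. g t)"
  unfolding set_lebesgue_integral_def
proof (rule integral_cong_AE)
  let ?h = "\<lambda>t. indicator {a<..<b} t *\<^sub>R f t"
  have h: "?h \<in> borel_measurable lebesgue" using f unfolding set_borel_measurable_def .
  have "(\<lambda>t. if t \<in> {a} then indicator {a..x} a *\<^sub>R f a else if t \<in> {b} then indicator {a..x} b *\<^sub>R f b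
      else indicator {a..x} t *\<^sub>R h t) \<in> borel_measurable lebesgue" if "h \<in> borel_measurable lebesgue" for h
    using that by (intro measurable_If_set borel_measurable_scaleR borel_measurable_indicator measurable_const) auto
  note this[OF h]
  also have "(\<lambda>t. if t \<in> {a} then indicator {a..x} a *\<^sub>R f a else if t \<in> {b} then indicator {a..x} b *\<^sub>R f b
      else indicator {a..x} t *\<^sub>R ?h t) = (\<lambda>t. indicator {a..x} t *\<^sub>R f t)"
    using x by (auto simp: fun_eq_iff indicator_def)
  finally show "(\<lambda>t. indicator {a..x} t *\<^sub>R f t) \<in> borel_measurable lebesgue" .
  have "set_integrable lebesgue {a..x} g" by (rule set_integrable_subset[OF g]) (use x in auto)
  then show "(\<lambda>t. indicator {a..x} t *\<^sub>R g t) \<in> borel_measurable lebesgue"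
    unfolding set_integrable_def by (rule borel_measurable_integrable)
  have "AE t in lebesgue. t \<noteq> a" "AE t in lebesgue. t \<noteq> b"
    using AE_lborel_singleton by (auto intro: AE_completion)
  with ae show "AE t in lebesgue. indicator {a..x} t *\<^sub>R f t = indicator {a..x} t *\<^sub>R g t"
  proof eventually_elim
    case (elim t)
    then show ?case using x by (cases "t \<in> {a..x}") auto
  qed
qed

text \<open>Regularity: almost everywhere \<open>u2 = (v - \<mu>) u\<close>, so \<open>u1\<close> is
  an indefinite integral of a function that is continuous off \<open>S\<close>, hence differentiable
  there. As \<open>v - \<mu>\<close> is real, real and imaginary parts separate.\<close>

lemma eigenfunction_schroed_sol:
  assumes v: "v \<in> borel_measurable borel" "\<And>x. \<bar>v x\<bar> \<le> B" "finite S" "\<And>x. x \<notin> S \<Longrightarrow> isCont v x"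
    and L: "L > 0" and u: "u \<in> eigenspace (dirichlet_schroedinger v L) \<mu>"
  obtains u1 where "schroed_sol v \<mu> (-L/2) (L/2) (\<lambda>x. Re (u x)) (\<lambda>x. Re (u1 x))"
    and "schroed_sol v \<mu> (-L/2) (L/2) (\<lambda>x. Im (u x)) (\<lambda>x. Im (u1 x))"
    and "\<And>x. x \<notin> {-L/2<..<L/2} \<Longrightarrow> u x = 0"
proof -
  define a b where ab: "a = -L/2" "b = L/2"
  have "a \<le> b" using L ab by simp
  obtain u1 u2 where out: "\<And>x. x \<notin> {a<..<b} \<Longrightarrow> u x = 0"
    and H: "H2_with_derivs a b u u1 u2"
    and ae: "AE x in lebesgue. x \<in> {a<..<b} \<longrightarrow>
              complex_of_real \<mu> * u x = - u2 x + complex_of_real (v x) * u x"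
    using u unfolding eigenspace_def dirichlet_schroedinger_def ab by blast
  have d: "(u has_vector_derivative u1 x) (at x within {a..b})" if "x \<in> {a..b}" for x
    using H that unfolding H2_with_derivs_def by blast
  have Hi: "u1 x = u1 a + (LINT t:{a..x}|lebesgue. u2 t)" if "x \<in> {a..b}" for x
    using H that unfolding H2_with_derivs_def by blast
  have Hm: "set_borel_measurable lebesgue {a<..<b} u2"
    using H unfolding H2_with_derivs_def square_integrable_on_def by blast
  from d have uc: "continuous_on {a..b} u" by (rule continuous_on_vector_derivative)
  let ?g = "\<lambda>x. complex_of_real (v x - \<mu>) * u x"
  have gi: "set_integrable lebesgue {a..b} ?g" by (rule set_integrable_potential_times[OF v(1,2) uc])
  then have gI: "?g integrable_on {a..b}" by (rule set_lebesgue_integral_eq_integral(1))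
  have u1: "u1 x = u1 a + integral {a..x} ?g" if "x \<in> {a..b}" for x
  proof -
    have "AE x in lebesgue. x \<in> {a<..<b} \<longrightarrow> u2 x = ?g x"
      using ae by eventually_elim (simp add: algebra_simps)
    then have "(LINT t:{a..x}|lebesgue. u2 t) = (LINT t:{a..x}|lebesgue. ?g t)"
      by (intro set_integral_cong_AE_Ioo[OF Hm gi]) (use that in auto)
    also have "\<dots> = integral {a..x} ?g"
      by (rule set_lebesgue_integral_eq_integral(2), rule set_integrable_subset[OF gi]) (use that in auto)
    finally show ?thesis using Hi[OF that] by (simp only:)
  qed
  have "continuous_on {a..b} (\<lambda>x. u1 a + integral {a..x} ?g)"
    by (intro continuous_intros indefinite_integral_continuous_1 gI)
  then have u1c: "continuous_on {a..b} u1" by (rule continuous_on_eq) (rule u1[symmetric])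
  have d1: "(u1 has_vector_derivative ?g x) (at x)" if x: "x \<in> {a<..<b} - S" for x
  proof -
    have "continuous (at x) u"
      by (rule continuous_on_interior[OF uc]) (use x in simp)
    moreover have "continuous (at x) v" using v(4) x by simp
    ultimately have "continuous (at x) ?g" by (intro continuous_intros)
    then have "continuous (at x within {a..b} - {}) ?g" by (rule continuous_at_imp_continuous_within)
    then have "((\<lambda>x. integral {a..x} ?g) has_vector_derivative ?g x) (at x within {a..b} - {})"
      by (intro integral_has_vector_derivative_continuous_at gI) (use x in auto)
    then have "((\<lambda>x. u1 a + integral {a..x} ?g) has_vector_derivative 0 + ?g x) (at x within {a..b})"
      by (intro has_vector_derivative_add has_vector_derivative_const) simp
    then have "(u1 has_vector_derivative ?g x) (at x within {a..b})"
      unfolding add_0 by (rule has_vector_derivative_transform[OF _ u1, rotated 2]) (use x in auto)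
    then show ?thesis using x at_within_Icc_at[of a x b] by simp
  qed
  have T: "schroed_sol v \<mu> a b (\<lambda>x. T (u x)) (\<lambda>x. T (u1 x))"
    if T: "bounded_linear T" "\<And>c z. T (complex_of_real c * z) = c * T z" for T :: "complex \<Rightarrow> real"
    unfolding schroed_sol_def
  proof (intro conjI exI[of _ S] ballI)
    show "((\<lambda>x. T (u x)) has_real_derivative T (u1 x)) (at x within {a..b})" if "x \<in> {a..b}" for x
      using bounded_linear.has_vector_derivative[OF T(1) d[OF that]]
      by (simp add: has_real_derivative_iff_has_vector_derivative)
    show "continuous_on {a..b} (\<lambda>x. T (u1 x))"
      by (rule bounded_linear.continuous_on[OF T(1) u1c])
    show "((\<lambda>x. T (u1 x)) has_real_derivative (v x - \<mu>) * T (u x)) (at x)" if "x \<in> {a<..<b} - S" for x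
      using bounded_linear.has_vector_derivative[OF T(1) d1[OF that]] T(2)[of "v x - \<mu>" "u x"]
      by (simp add: has_real_derivative_iff_has_vector_derivative)
  qed (rule v(3))
  show thesis
    using that T[OF bounded_linear_Re] T[OF bounded_linear_Im] out unfolding ab by simp
qed

text \<open>The fundamental theorem of calculus tolerates the finite exceptional set, so
  \<open>u'\<close> is the integral of \<open>(v - \<mu>) u\<close>, which serves as weak second
  derivative.\<close>

lemma schroed_sol_eigenfunction:
  assumes v: "v \<in> borel_measurable borel" "\<And>x. \<bar>v x\<bar> \<le> B" and L: "L > 0"
    and sol: "schroed_sol v \<mu> (-L/2) (L/2) u u'" and bc: "u (-L/2) = 0" "u (L/2) = 0"
  shows "(\<lambda>x. if x \<in> {-L/2<..<L/2} then complex_of_real (u x) else 0)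
    \<in> eigenspace (dirichlet_schroedinger v L) \<mu>" (is "?U \<in> _")
proof -
  define a b where ab: "a = -L/2" "b = L/2"
  obtain S where S: "finite S" and c: "continuous_on {a..b} u" "continuous_on {a..b} u'"
    and d': "\<And>x. x \<in> {a<..<b} - S \<Longrightarrow> (u' has_real_derivative (v x - \<mu>) * u x) (at x)"
    using schroed_solE[OF sol] unfolding ab by metis
  have d: "(u has_real_derivative u' x) (at x within {a..b})" if "x \<in> {a..b}" for x
    using sol that unfolding schroed_sol_def ab by blast
  have U: "?U x = complex_of_real (u x)" if "x \<in> {a..b}" for x
    using that bc unfolding ab by (cases "x = -L/2"; cases "x = L/2") auto
  have "?U = (\<lambda>x. indicator {a..b} x *\<^sub>R complex_of_real (u x))"
    using bc L unfolding ab by (auto simp: fun_eq_iff indicator_def)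
  moreover have "(\<lambda>x. indicator {a..b} x *\<^sub>R complex_of_real (u x)) \<in> borel_measurable borel"
    using c(1) by (intro borel_measurable_continuous_on_indicator continuous_intros) auto
  ultimately have Um: "?U \<in> borel_measurable borel" by simp
  have "bounded (u ` {a..b})"
    using c(1) compact_continuous_image compact_imp_bounded by blast
  then obtain C where "\<forall>y\<in>u ` {a..b}. norm y \<le> C" unfolding bounded_iff by blast
  then have "\<bar>u x\<bar> \<le> \<bar>C\<bar>" if "x \<in> {a..b}" for x
    using that order_trans[OF _ abs_ge_self, of "\<bar>u x\<bar>" C] by simp
  then have C: "cmod (?U x) \<le> \<bar>C\<bar>" for x unfolding ab by auto
  have Uc: "continuous_on {a..b} ?U"
    by (rule continuous_on_eq[where f = "\<lambda>x. complex_of_real (u x)"]) (use c(1) U in \<open>auto intro!: continuous_intros\<close>)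
  let ?g = "\<lambda>x. complex_of_real (v x - \<mu>) * ?U x"
  have gi: "set_integrable lebesgue {a..b} ?g"
    by (rule set_integrable_potential_times[OF v Uc])
  have g2: "square_integrable_on ?g {a<..<b}"
  proof (rule square_integrable_on_bounded[where B = "(B + \<bar>\<mu>\<bar>) * \<bar>C\<bar>"])
    show "?g \<in> borel_measurable borel" using Um v(1) by measurable
    fix x
    have "\<bar>v x - \<mu>\<bar> \<le> B + \<bar>\<mu>\<bar>" using v(2)[of x] by linarith
    then show "cmod (?g x) \<le> (B + \<bar>\<mu>\<bar>) * \<bar>C\<bar>"
      unfolding norm_mult norm_of_real using C[of x] by (intro mult_mono) auto
  qed
  have "H2_with_derivs a b ?U (\<lambda>x. complex_of_real (u' x)) ?g"
    unfolding H2_with_derivs_def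
  proof (intro conjI ballI)
    fix x assume x: "x \<in> {a..b}"
    have "((\<lambda>x. complex_of_real (u x)) has_vector_derivative complex_of_real (u' x)) (at x within {a..b})"
      using d[OF x] by (simp add: has_real_derivative_iff_has_vector_derivative has_vector_derivative_of_real)
    then show "(?U has_vector_derivative complex_of_real (u' x)) (at x within {a..b})"
      by (rule has_vector_derivative_transform[OF x, rotated]) (rule U)
    have "((\<lambda>t. (v t - \<mu>) * u t) has_integral (u' x - u' a)) {a..x}"
      using S x d' by (intro fundamental_theorem_of_calculus_interior_strong[of S] continuous_on_subset[OF c(2)])
        (auto simp flip: has_real_derivative_iff_has_vector_derivative)
    then have "((\<lambda>t. complex_of_real ((v t - \<mu>) * u t)) has_integral complex_of_real (u' x - u' a)) {a..x}"
      by (rule has_integral_of_real)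
    then have "(?g has_integral complex_of_real (u' x - u' a)) {a..x}"
      by (rule has_integral_eq[rotated]) (use U x in auto)
    moreover have "(LINT t:{a..x}|lebesgue. ?g t) = integral {a..x} ?g"
      by (rule set_lebesgue_integral_eq_integral(2), rule set_integrable_subset[OF gi]) (use x in auto)
    ultimately show "complex_of_real (u' x) = complex_of_real (u' a) + (LINT t:{a..x}|lebesgue. ?g t)"
      by (simp add: integral_unique)
  qed (rule g2)
  moreover have "square_integrable_on (\<lambda>x. complex_of_real \<mu> * ?U x) {a<..<b}"
  proof (rule square_integrable_on_bounded[where B = "\<bar>\<mu>\<bar> * \<bar>C\<bar>"])
    show "(\<lambda>x. complex_of_real \<mu> * ?U x) \<in> borel_measurable borel" using Um by measurable
    show "cmod (complex_of_real \<mu> * ?U x) \<le> \<bar>\<mu>\<bar> * \<bar>C\<bar>" for x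
      unfolding norm_mult norm_of_real using C[of x] by (intro mult_mono) auto
  qed
  moreover have "AE x in lebesgue. x \<in> {a<..<b} \<longrightarrow>
      complex_of_real \<mu> * ?U x = - ?g x + complex_of_real (v x) * ?U x"
    by (intro always_eventually) (simp add: algebra_simps)
  ultimately show ?thesis
    unfolding eigenspace_def dirichlet_schroedinger_def ab mem_Collect_eq case_prod_conv
    by (intro conjI exI[of _ "\<lambda>x. complex_of_real (u' x)"] exI[of _ ?g]) (simp, assumption+)
qed

section \<open>Counting eigenvalues with multiplicity\<close>

lemma eigenvalue_mult_eq_1:
  assumes w: "w \<in> eigenspace T \<mu>" "w \<noteq> 0" and *: "\<And>u. u \<in> eigenspace T \<mu> \<Longrightarrow> \<exists>c. u = (\<lambda>x. c * w x)"
  shows "eigenvalue_mult T \<mu> = 1"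
  unfolding eigenvalue_mult_def
proof (rule cfun.dim_unique[of "{w}"])
  show "cfun.independent {w}" using w(2) by (simp add: cfun.independent_insert)
  show "eigenspace T \<mu> \<subseteq> cfun.span {w}"
    using * cfun.span_scale[OF cfun.span_base[of w "{w}"]] by fastforce
qed (use w(1) in auto)

text \<open>The counting function is 0 below \<open>e0\<close>, 1 on \<open>[e0, e1)\<close> and 2
  at \<open>e1\<close>, so both infima are attained minima. It is evaluated only up to
  \<open>e1\<close>.\<close>

lemma nth_eigenvalue_0_1:
  assumes e: "is_eigenvalue T e0" "is_eigenvalue T e1" "e0 < e1"
    and only: "\<And>\<mu>. is_eigenvalue T \<mu> \<Longrightarrow> \<mu> \<le> e1 \<Longrightarrow> \<mu> = e0 \<or> \<mu> = e1"
    and mult: "eigenvalue_mult T e0 = 1" "eigenvalue_mult T e1 = 1"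
  shows "nth_eigenvalue T 1 = e1"
    and "nth_eigenvalue T 0 = e0"
proof -
  let ?N = "\<lambda>c. \<Sum>\<mu> | is_eigenvalue T \<mu> \<and> \<mu> \<le> c. eigenvalue_mult T \<mu>"
  have N0: "?N c = 0" if "c < e0" for c
  proof -
    have "{\<mu>. is_eigenvalue T \<mu> \<and> \<mu> \<le> c} = {}" using only that e by fastforce
    then show ?thesis by (simp only: sum.empty)
  qed
  have N1: "?N c = 1" if "e0 \<le> c" "c < e1" for c
  proof -
    have "{\<mu>. is_eigenvalue T \<mu> \<and> \<mu> \<le> c} = {e0}" using only that e by fastforce
    then show ?thesis using mult by (simp only:) simp
  qed
  have N2: "?N e1 = 2"
  proof -
    have "{\<mu>. is_eigenvalue T \<mu> \<and> \<mu> \<le> e1} = {e0, e1}" using only e by fastforce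
    then show ?thesis using mult e by (simp only:) simp
  qed
  show "nth_eigenvalue T 1 = e1"
    unfolding nth_eigenvalue_def
  proof (rule cInf_eq_minimum)
    show "e1 \<in> {c. 1 < ?N c}" using N2 by simp
    show "e1 \<le> c" if "c \<in> {c. 1 < ?N c}" for c
      using that N0[of c] N1[of c] by (cases "c < e0"; cases "c < e1") auto
  qed
  show "nth_eigenvalue T 0 = e0"
    unfolding nth_eigenvalue_def
  proof (rule cInf_eq_minimum)
    show "e0 \<in> {c. 0 < ?N c}" using N1[of e0] e by simp
    show "e0 \<le> c" if "c \<in> {c. 0 < ?N c}" for c
      using that N0[of c] by (cases "c < e0") auto
  qed
qed

section \<open>Oscillation\<close>

lemma shoot_zero_spacing:
  assumes "k > 0" "p < q" "shoot M k p = 0" "shoot M k q = 0" "k * (q - p) < pi"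
  shows "shoot' M k q = 0"
  by (rule sturm_zero_spacing[OF schroed_sol_shoot[OF assms(1)] assms(2-4) assms(1,5)])
    (simp add: inverse_square_potential_bounds)

text \<open>A zero with zero slope makes the solution trivial. The conclusion contradicts the slope
  \<open>- sqrt 5\<close> from \<open>shoot_end\<close>, which is how it is used.\<close>

lemma shoot_unique:
  assumes "k > 0" "z \<le> M" "shoot M k z = 0" "shoot' M k z = 0"
  shows "shoot' M k M = 0"
  by (rule V_sol_unique(2)[OF schroed_sol_shoot[OF assms(1)], where z = z and a = z and b = M]) (use assms in auto)

text \<open>The negative slope at \<open>M\<close> makes the solution positive just before
  \<open>M\<close>; a nonpositive value further left then yields a zero by the intermediate value
  theorem.\<close>

lemma shoot_zero_between:
  assumes "M > 1" "k > 0" "x0 < M" "shoot M k x0 \<le> 0"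
  obtains z where "x0 \<le> z" "z < M" "shoot M k z = 0"
proof -
  obtain d where d: "d > 0" "\<And>h. 0 < h \<Longrightarrow> h < d \<Longrightarrow> shoot M k M < shoot M k (M - h)"
    using DERIV_neg_dec_left[OF shoot_has_derivative[OF assms(2)], of M M] shoot_end[OF assms(1)] by auto
  define y where "y = M - min (d / 2) ((M - x0) / 2)"
  have y: "x0 \<le> y" "y < M" using d(1) assms(3) unfolding y_def by (auto simp: min_def field_simps)
  have "0 < shoot M k y"
    using d(2)[of "min (d / 2) ((M - x0) / 2)"] d(1) assms(3) shoot_end[OF assms(1)] unfolding y_def by (auto simp: min_def)
  moreover have "continuous_on {x0..y} (shoot M k)"
    using DERIV_isCont[OF shoot_has_derivative[OF assms(2)]] by (intro continuous_at_imp_continuous_on) auto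
  ultimately obtain z where "x0 \<le> z" "z \<le> y" "shoot M k z = 0"
    using IVT'[of "shoot M k" x0 0 y] assms(4) y by auto
  with y that show thesis by auto
qed

lemma shoot_pos:
  assumes "M > 1" "k > 0" "x < M" "k * (M - x) < pi"
  shows "shoot M k x > 0"
proof (rule ccontr)
  assume "\<not> shoot M k x > 0"
  then obtain z where z: "x \<le> z" "z < M" "shoot M k z = 0"
    using shoot_zero_between[OF assms(1-3)] by auto
  have "k * (M - z) \<le> k * (M - x)" using z assms(2) by simp
  with assms(4) have "k * (M - z) < pi" by linarith
  then have "shoot' M k M = 0"
    using z assms shoot_end[OF assms(1)] by (intro shoot_zero_spacing[of k z M]) auto
  then show False using shoot_end[OF assms(1)] by simp
qed

text \<open>Here \<open>k (M - x)\<close> may exceed \<open>pi\<close>, so \<open>shoot_pos\<close>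
  does not suffice; the barrier bound excludes the zero instead.\<close>

lemma shoot_pos_barrier:
  assumes "M \<ge> 1500" "k > 0" "k\<^sup>2 \<le> 10 / M\<^sup>2" "- 8 / 1000 * M \<le> x" "x < M"
  shows "shoot M k x > 0"
proof (rule ccontr)
  have M: "M > 1" using assms by simp
  assume "\<not> shoot M k x > 0"
  then obtain z where z: "x \<le> z" "z < M" "shoot M k z = 0"
    using shoot_zero_between[OF M assms(2,5)] by auto
  have "shoot' M k M = 0"
    by (rule zero_near_barrier_bound[OF schroed_sol_shoot[OF assms(2)] z(3)])
      (use z assms shoot_end[OF M] in auto)
  then show False using shoot_end[OF M] by simp
qed

lemma shoot_neg_M:
  assumes "M > 1" "k > 0"
  shows "shoot M k (- M) = shoot M k 0 * cos (k * M) - shoot' M k 0 / k * sin (k * M)"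
  using shoot_left[of "- M" k M] assms by simp

lemma continuous_on_shoot_Icc:
  assumes "x \<le> 1" "a > 0" shows "continuous_on {a..b} (\<lambda>k. shoot M k x)"
  by (rule continuous_on_subset[OF continuous_on_shoot[OF assms(1)]]) (use assms in auto)

section \<open>Signs of the value at \<open>-M\<close> as \<open>k\<close> varies\<close>

lemma pi_squared_less_10: "pi\<^sup>2 < 10"
proof -
  have "pi\<^sup>2 \<le> (315 / 100)\<^sup>2" using pi_approx by (intro power_mono) auto
  then show ?thesis by (simp add: power2_eq_square)
qed

text \<open>At \<open>k M = pi\<close> the sine term drops out and the value at \<open>-M\<close> is
  minus the value at 0, which is positive by the barrier because
  \<open>pi\<^sup>2 < 10\<close>.\<close>

lemma shoot_neg_at_pi:
  assumes "M \<ge> 1500" shows "shoot M (pi / M) (- M) < 0"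
proof -
  have M: "M > 1" using assms by simp
  have "shoot M (pi / M) 0 > 0"
    using assms pi_squared_less_10 by (intro shoot_pos_barrier) (auto simp: power_divide divide_right_mono)
  then show ?thesis using shoot_neg_M[OF M, of "pi / M"] M by simp
qed

text \<open>At this frequency a half wave has length exactly \<open>2 M\<close>. A negative value at
  \<open>-M\<close> would put a zero strictly inside, closer to \<open>M\<close> than a half
  wave.\<close>

lemma shoot_nonneg_at_half_pi:
  assumes "M > 1" shows "shoot M (pi / (2 * M)) (- M) \<ge> 0"
proof (rule ccontr)
  let ?k = "pi / (2 * M)"
  assume neg: "\<not> shoot M ?k (- M) \<ge> 0"
  then obtain z where z: "- M \<le> z" "z < M" "shoot M ?k z = 0"
    using shoot_zero_between[OF assms, of ?k "- M"] assms by auto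
  then have "z \<noteq> - M" using neg by auto
  then have "- M < z" using z by simp
  then have "?k * (M - z) < ?k * (M - - M)" using assms by (intro mult_strict_left_mono) auto
  also have "?k * (M - - M) = pi" using assms by (simp add: field_simps)
  finally show False using shoot_pos[of M ?k z] z assms by auto
qed

lemma first_shoot_zero:
  assumes "M \<ge> 1500"
  obtains k where "0 < k" "k < pi / M" "shoot M k (- M) = 0"
proof -
  have M: "M > 1" using assms by simp
  have "pi / (2 * M) \<le> pi / M" using M by (intro divide_left_mono) auto
  moreover have "continuous_on {pi / (2 * M)..pi / M} (\<lambda>k. shoot M k (- M))"
    using M by (intro continuous_on_shoot_Icc) auto
  ultimately obtain k where k: "pi / (2 * M) \<le> k" "k \<le> pi / M" "shoot M k (- M) = 0"
    using IVT2'[of "\<lambda>k. shoot M k (- M)" "pi / M" 0 "pi / (2 * M)"]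
      shoot_neg_at_pi[OF assms] shoot_nonneg_at_half_pi[OF M] by auto
  moreover have "k \<noteq> pi / M" using k shoot_neg_at_pi[OF assms] by auto
  moreover have "0 < pi / (2 * M)" using M by simp
  ultimately show thesis using that[of k] by linarith
qed

text \<open>A zero of \<open>shoot\<close> inside \<open>{0<..<M}\<close> would leave an interval of length at most
  \<open>M / 2\<close> between two zeros, which is too short for the frequency \<open>k\<close>.\<close>

lemma shoot'_nonneg_at_0:
  assumes M: "M > 1" and k: "0 < k" "k < 2 * pi / M" and z0: "shoot M k 0 = 0"
  shows "shoot' M k 0 \<ge> 0"
proof (rule ccontr)
  assume "\<not> shoot' M k 0 \<ge> 0"
  then obtain d where d: "d > 0" "\<And>h. 0 < h \<Longrightarrow> h < d \<Longrightarrow> shoot M k (0 + h) < shoot M k 0"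
    using DERIV_neg_dec_right[OF shoot_has_derivative[OF k(1)], of M 0] by auto
  define y where "y = min (d / 2) (M / 2)"
  have y: "0 < y" "y < M" "y < d" using d(1) M unfolding y_def by (auto simp: min_def)
  have "shoot M k y < 0" using d(2)[of y] y z0 by simp
  then obtain z where z: "y \<le> z" "z < M" "shoot M k z = 0"
    using shoot_zero_between[OF M k(1) y(2)] by auto
  have kM: "k * (M / 2) < pi" using k(2) M by (simp add: field_simps)
  show False
  proof (cases "z \<le> M / 2")
    case True
    have "k * (z - 0) \<le> k * (M / 2)" using True k by simp
    with kM have "k * (z - 0) < pi" by linarith
    then have "shoot' M k z = 0"
      using z y k kM z0 by (intro shoot_zero_spacing[of k 0 z]) auto
    then have "shoot' M k M = 0" using shoot_unique[OF k(1), of z M] z by simp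
    then show False using shoot_end[OF M] by simp
  next
    case False
    then have "k * (M - z) \<le> k * (M / 2)" using k by (intro mult_left_mono) auto
    with kM have "k * (M - z) < pi" by linarith
    then show False using shoot_pos[OF M k(1) z(2)] z(3) by simp
  qed
qed

text \<open>Some \<open>r\<close> with a nonnegative value at \<open>-M\<close> is needed. Either
  the value at 0 is still nonnegative for \<open>2 pi / M\<close>, where it equals the value at
  \<open>-M\<close>; or it vanishes for some \<open>r\<close> in between, where the value at
  \<open>-M\<close> is \<open>- shoot' M r 0 / r * sin (r * M)\<close> with nonnegative slope and
  nonpositive sine.\<close>

lemma second_shoot_zero:
  assumes "M \<ge> 1500"
  obtains k where "pi / M < k" "k \<le> 2 * pi / M" "shoot M k (- M) = 0"
proof -
  have M: "M > 1" using assms by simp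
  let ?p = "pi / M" and ?q = "2 * pi / M"
  have pq: "0 < ?p" "?p \<le> ?q" using M by (auto intro!: divide_right_mono)
  obtain r where r: "?p \<le> r" "r \<le> ?q" "shoot M r (- M) \<ge> 0"
  proof (cases "shoot M ?q 0 \<ge> 0")
    case True
    have "?q * M = 2 * pi" using M by simp
    then have "shoot M ?q (- M) \<ge> 0" using True shoot_neg_M[OF M, of ?q] pq by simp
    then show thesis using that[of ?q] pq by simp
  next
    case False
    have "?p * M = pi" using M by simp
    then have "shoot M ?p (- M) = - shoot M ?p 0" using shoot_neg_M[OF M, of ?p] pq by simp
    then have "shoot M ?p 0 > 0" using shoot_neg_at_pi[OF assms] by simp
    then obtain r where r: "?p \<le> r" "r \<le> ?q" "shoot M r 0 = 0"
      using IVT2'[of "\<lambda>k. shoot M k 0" ?q 0 ?p] False pq continuous_on_shoot_Icc[of 0 ?p ?q M] by auto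
    then have "r \<noteq> ?q" using False by auto
    then have rq: "0 < r" "r < ?q" using r pq by auto
    have "pi \<le> r * M" "r * M < 2 * pi" using r rq M by (auto simp: field_simps)
    then have "sin (r * M) \<le> 0" by (intro sin_le_zero) auto
    then have "shoot' M r 0 / r * sin (r * M) \<le> 0"
      using shoot'_nonneg_at_0[OF M rq r(3)] rq by (intro mult_nonneg_nonpos) auto
    then have "shoot M r (- M) \<ge> 0" using shoot_neg_M[OF M rq(1)] r(3) by simp
    then show thesis using that[of r] r by simp
  qed
  have "continuous_on {?p..r} (\<lambda>k. shoot M k (- M))"
    using M pq by (intro continuous_on_shoot_Icc) auto
  then obtain k where k: "?p \<le> k" "k \<le> r" "shoot M k (- M) = 0"
    using IVT'[of "\<lambda>k. shoot M k (- M)" ?p 0 r] shoot_neg_at_pi[OF assms] r by auto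
  moreover have "k \<noteq> ?p" using k shoot_neg_at_pi[OF assms] by auto
  ultimately show thesis using that[of k] r by simp
qed

text \<open>The barrier pushes any inner zero to the left of \<open>- 8 / 1000 * M\<close>; it is
  then too close to the zero at \<open>-M\<close>.\<close>

lemma low_shoot_pos:
  assumes "M \<ge> 1500" "k > 0" "k\<^sup>2 \<le> 10 / M\<^sup>2" "shoot M k (- M) = 0" "- M < x" "x < M"
  shows "shoot M k x > 0"
proof (rule ccontr)
  have M: "M > 1" using assms by simp
  assume "\<not> shoot M k x > 0"
  then obtain z where z: "x \<le> z" "z < M" "shoot M k z = 0"
    using shoot_zero_between[OF M assms(2,6)] by auto
  have "z < - 8 / 1000 * M" using shoot_pos_barrier[OF assms(1-3), of z] z by force
  then have "k * (z - - M) \<le> k * (992 / 1000 * M)" using assms by (intro mult_left_mono) auto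
  also have "\<dots> = (k * M) * (992 / 1000)" by simp
  also have "\<dots> < pi"
  proof -
    \<comment> \<open>3.165 is a rational upper bound for \<open>sqrt 10\<close>, and
      \<open>3.165 * 0.992 < 3.14\<close>; this is what the cut at \<open>- 8 / 1000 * M\<close> has
      to ensure.\<close>
    have "(k * M)\<^sup>2 \<le> (3165 / 1000)\<^sup>2"
      using assms(1,3) by (simp add: power_mult_distrib field_simps power2_eq_square)
    then have "k * M \<le> 3165 / 1000" by (rule power2_le_imp_le) simp
    then show ?thesis using pi_approx by simp
  qed
  finally have "shoot' M k z = 0"
    using z assms by (intro shoot_zero_spacing[of k "- M" z]) auto
  then have "shoot' M k M = 0" using shoot_unique[OF assms(2), of z M] z by simp
  then show False using shoot_end[OF M] by simp
qed

text \<open>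
  Both solutions are positive inside \<open>(-M, M)\<close>, yet orthogonal, since their Wronskian vanishes at
  both end points.
\<close>

lemma low_shoot_zero_unique:
  assumes M: "M \<ge> 1500" and k: "0 < k1" "k1 < k2" "k2\<^sup>2 \<le> 10 / M\<^sup>2"
    and z: "shoot M k1 (- M) = 0" "shoot M k2 (- M) = 0"
  shows False
proof -
  have M1: "M > 1" "k2 > 0" using M k by auto
  have kk: "k1\<^sup>2 < k2\<^sup>2" using k by (intro power_strict_mono) auto
  let ?u = "shoot M k1" and ?w = "shoot M k2" and ?u' = "shoot' M k1" and ?w' = "shoot' M k2"
  obtain S where S: "finite S" and cu: "continuous_on {-M..M} ?u" "continuous_on {-M..M} ?u'"
    and du: "\<And>x. x \<in> {-M<..<M} - S \<Longrightarrow> (?u has_real_derivative ?u' x) (at x)"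
      "\<And>x. x \<in> {-M<..<M} - S \<Longrightarrow> (?u' has_real_derivative (V x - k1\<^sup>2) * ?u x) (at x)"
    using schroed_solE[OF schroed_sol_shoot[OF k(1), of "- M" M M]] by metis
  obtain T where T: "finite T" and cw: "continuous_on {-M..M} ?w" "continuous_on {-M..M} ?w'"
    and dw: "\<And>x. x \<in> {-M<..<M} - T \<Longrightarrow> (?w has_real_derivative ?w' x) (at x)"
      "\<And>x. x \<in> {-M<..<M} - T \<Longrightarrow> (?w' has_real_derivative (V x - k2\<^sup>2) * ?w x) (at x)"
    using schroed_solE[OF schroed_sol_shoot[OF M1(2), of "- M" M M]] by metis
  let ?W = "\<lambda>x. ?u' x * ?w x - ?u x * ?w' x"
  \<comment> \<open>In the derivative of the Wronskian the potential cancels and only the difference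
    of the energies remains.\<close>
  let ?g = "\<lambda>x. (k2\<^sup>2 - k1\<^sup>2) * (?u x * ?w x)"
  have "(?W has_real_derivative ?g x) (at x)" if x: "x \<in> {-M<..<M} - (S \<union> T)" for x
  proof -
    have "x \<in> {-M<..<M} - S" "x \<in> {-M<..<M} - T" using x by auto
    then show ?thesis
      by (intro DERIV_cong[OF DERIV_diff[OF DERIV_mult[OF du(2) dw(1)] DERIV_mult[OF du(1) dw(2)]]])
        (auto simp: algebra_simps)
  qed
  then have "(?g has_integral ?W M - ?W (- M)) {-M..M}"
    using S T cu cw M1
    by (intro fundamental_theorem_of_calculus_interior_strong[of "S \<union> T"])
      (auto simp flip: has_real_derivative_iff_has_vector_derivative intro!: continuous_intros)
  moreover have "?W M = 0" "?W (- M) = 0" using z shoot_end[OF M1(1)] by auto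
  ultimately have "(?g has_integral 0) {-M..M}" by (simp only: diff_self)
  then have I: "integral {-M..M} ?g = 0" by (rule integral_unique)
  have k1: "k1\<^sup>2 \<le> 10 / M\<^sup>2" using kk k by linarith
  have pos: "0 < ?g x" if "- M < x" "x < M" for x
    using low_shoot_pos[OF M k(1) k1 z(1) that] low_shoot_pos[OF M M1(2) k(3) z(2) that] kk by simp
  have "0 \<le> ?g x" if "x \<in> {-M..M}" for x
  proof (cases "x = - M \<or> x = M")
    case True
    then show ?thesis using z shoot_end[OF M1(1)] by auto
  next
    case False
    then show ?thesis using pos[of x] that by (intro less_imp_le) auto
  qed
  moreover have "continuous_on {-M..M} ?g" using cu cw by (intro continuous_intros)
  ultimately have "\<forall>x\<in>{-M..M}. ?g x = 0" using integral_eq_0_iff[of "-M" M ?g] I M1 by auto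
  moreover have "0 \<in> {-M..M}" using M1 by simp
  ultimately have "?g 0 = 0" by (rule bspec)
  moreover have "0 < ?g 0" by (rule pos) (use M1 in simp_all)
  ultimately show False by linarith
qed

section \<open>The two lowest eigenvalues\<close>

lemma borel_measurable_V: "V \<in> borel_measurable borel"
  unfolding inverse_square_potential_def[abs_def] by measurable

lemma isCont_V: assumes "x \<noteq> 1" shows "isCont V x"
proof (cases "x < 1")
  case True
  then have "\<forall>\<^sub>F y in nhds x. V y = 0"
    using eventually_nhds_in_open[of "{..<1}" x] by (auto elim!: eventually_mono simp: inverse_square_potential_simps)
  then show ?thesis by (subst isCont_cong) auto
next
  case False
  with assms have "x > 1" by simp
  then have "\<forall>\<^sub>F y in nhds x. V y = 1 / y\<^sup>2"
    using eventually_nhds_in_open[of "{1<..}" x] by (auto elim!: eventually_mono simp: inverse_square_potential_simps)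
  with \<open>x > 1\<close> show ?thesis by (subst isCont_cong) (auto intro!: continuous_intros)
qed

abbreviation (input) "T M \<equiv> dirichlet_schroedinger V (2 * M)"

lemma eigenspace_V_E:
  assumes "M > 0" "u \<in> eigenspace (T M) \<mu>"
  obtains u1 where "schroed_sol V \<mu> (- M) M (\<lambda>x. Re (u x)) (\<lambda>x. Re (u1 x))"
    and "schroed_sol V \<mu> (- M) M (\<lambda>x. Im (u x)) (\<lambda>x. Im (u1 x))"
    and "\<And>x. x \<notin> {- M<..<M} \<Longrightarrow> u x = 0"
proof -
  have "\<bar>V x\<bar> \<le> 1" for x using inverse_square_potential_bounds[of x] by simp
  from eigenfunction_schroed_sol[OF borel_measurable_V this, of "{1}" "2 * M"] show thesis
    using assms isCont_V that by auto
qed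

lemma is_eigenvalue_V_E:
  assumes "M > 0" "is_eigenvalue (T M) \<mu>"
  obtains u u' x where "schroed_sol V \<mu> (- M) M u u'" "u (- M) = 0" "u M = 0" "x \<in> {- M..M}" "u x \<noteq> 0"
proof -
  obtain u where u: "u \<in> eigenspace (T M) \<mu>" "u \<noteq> 0" using assms unfolding is_eigenvalue_def by blast
  from eigenspace_V_E[OF assms(1) u(1)] obtain u1
    where s: "schroed_sol V \<mu> (- M) M (\<lambda>x. Re (u x)) (\<lambda>x. Re (u1 x))"
      "schroed_sol V \<mu> (- M) M (\<lambda>x. Im (u x)) (\<lambda>x. Im (u1 x))"
    and o: "\<And>x. x \<notin> {- M<..<M} \<Longrightarrow> u x = 0" by blast
  obtain x where x: "u x \<noteq> 0" using u(2) by (auto simp: fun_eq_iff)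
  then have "x \<in> {- M..M}" using o[of x] by (cases "x \<in> {- M<..<M}") auto
  moreover have "Re (u x) \<noteq> 0 \<or> Im (u x) \<noteq> 0" using x by (simp add: complex_eq_iff)
  ultimately show thesis
    using that[OF s(1), of x] that[OF s(2), of x] o[of M] o[of "- M"] by auto
qed

text \<open>Positivity allows \<open>\<mu> = k\<^sup>2\<close> with \<open>k > 0\<close>, as
  shooting requires. For \<open>\<mu> \<le> 0\<close> a wave of frequency \<open>1 / M\<close>
  serves as comparison: its phase over the whole interval is \<open>2 < pi\<close>.\<close>

lemma is_eigenvalue_V_pos:
  assumes "M > 1" "is_eigenvalue (T M) \<mu>"
  shows "\<mu> > 0"
proof (rule ccontr)
  assume \<mu>: "\<not> \<mu> > 0"
  obtain u u' x where u: "schroed_sol V \<mu> (- M) M u u'" "u (- M) = 0" "u M = 0" "x \<in> {- M..M}" "u x \<noteq> 0"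
    using is_eigenvalue_V_E[of M \<mu>] assms by auto
  have "u' M = 0"
  proof (rule sturm_zero_spacing[OF u(1) _ u(2,3), of "1 / M"])
    show "1 / M * (M - - M) < pi" using assms pi_gt3 by simp
    show "- (1 / M)\<^sup>2 \<le> V x - \<mu>" for x
      using \<mu> inverse_square_potential_bounds(1)[of x] zero_le_power2[of "1 / M"] by linarith
  qed (use assms in auto)
  then have "u x = 0" using V_sol_unique(1)[OF u(1), of M x] u assms by auto
  with u show False by simp
qed

text \<open>The factor \<open>c\<close> is chosen to match the slopes at \<open>M\<close>, so the
  difference has zero Cauchy data there. Eigenvalues are therefore simple.\<close>

lemma schroed_sol_proportional:
  assumes "M > 1" "k > 0" and u: "schroed_sol V (k\<^sup>2) (- M) M u u'" "u M = 0"
  obtains c where "\<And>x. x \<in> {- M..M} \<Longrightarrow> u x = c * shoot M k x"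
proof -
  define c where "c = - u' M / sqrt 5"
  note d = schroed_sol_lincomb[OF u(1) schroed_sol_shoot[OF assms(2), of "- M" M M], of c]
  have "u x - c * shoot M k x = 0" if "x \<in> {- M..M}" for x
    by (rule V_sol_unique(1)[OF d, of M]) (use that assms(1) u(2) shoot_end[OF assms(1)] in \<open>auto simp: c_def\<close>)
  then show thesis using that[of c] by simp
qed

lemma shoot_eigenfunction:
  assumes "M > 1" "k > 0" "shoot M k (- M) = 0"
  defines "w \<equiv> \<lambda>x. if x \<in> {- M<..<M} then complex_of_real (shoot M k x) else 0"
  shows "w \<in> eigenspace (T M) (k\<^sup>2)" "w \<noteq> 0"
proof -
  have "\<bar>V x\<bar> \<le> 1" for x using inverse_square_potential_bounds[of x] by simp
  from schroed_sol_eigenfunction[OF borel_measurable_V this, of "2 * M" "k\<^sup>2" "shoot M k" "shoot' M k"]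
  show "w \<in> eigenspace (T M) (k\<^sup>2)"
    using assms shoot_end[of M k] schroed_sol_shoot[OF assms(2), of "- M" M M] by simp
  \<comment> \<open>A point within \<open>1 / k\<close> of \<open>M\<close>, where the phase
    \<open>k (M - y) \<le> 1\<close> guarantees positivity; the maximum with 0 keeps it inside the
    interval.\<close>
  define y where "y = max 0 (M - 1 / k)"
  have y: "y \<in> {- M<..<M}" using assms unfolding y_def by auto
  have "k * (M - y) \<le> k * (1 / k)" using assms(2) unfolding y_def by (intro mult_left_mono) auto
  then have "k * (M - y) < pi" using assms(2) pi_gt3 by simp
  then have "w y \<noteq> 0" using shoot_pos[of M k y] assms y by simp
  then show "w \<noteq> 0" by auto
qed

lemma is_eigenvalue_V_iff:
  assumes "M > 1"
  shows "is_eigenvalue (T M) \<mu> \<longleftrightarrow> (\<exists>k>0. \<mu> = k\<^sup>2 \<and> shoot M k (- M) = 0)"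
proof
  assume e: "is_eigenvalue (T M) \<mu>"
  then have "\<mu> > 0" using is_eigenvalue_V_pos[OF assms] by simp
  then have k: "sqrt \<mu> > 0" "\<mu> = (sqrt \<mu>)\<^sup>2" by simp_all
  obtain u u' x where u: "schroed_sol V \<mu> (- M) M u u'" "u (- M) = 0" "u M = 0" "x \<in> {- M..M}" "u x \<noteq> 0"
    using is_eigenvalue_V_E[of M \<mu>] assms e by auto
  obtain c where c: "\<And>x. x \<in> {- M..M} \<Longrightarrow> u x = c * shoot M (sqrt \<mu>) x"
    using schroed_sol_proportional[OF assms k(1), of u u'] u k by metis
  have "c \<noteq> 0" using c[OF u(4)] u(5) by auto
  moreover have "c * shoot M (sqrt \<mu>) (- M) = 0" using c[of "- M"] u(2) assms by simp
  ultimately show "\<exists>k>0. \<mu> = k\<^sup>2 \<and> shoot M k (- M) = 0" using k by (intro exI[of _ "sqrt \<mu>"]) simp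
next
  assume "\<exists>k>0. \<mu> = k\<^sup>2 \<and> shoot M k (- M) = 0"
  then show "is_eigenvalue (T M) \<mu>"
    using shoot_eigenfunction[OF assms] unfolding is_eigenvalue_def by blast
qed

lemma eigenvalue_mult_V:
  assumes "M > 1" "k > 0" "shoot M k (- M) = 0"
  shows "eigenvalue_mult (T M) (k\<^sup>2) = 1"
proof (rule eigenvalue_mult_eq_1[OF shoot_eigenfunction[OF assms]])
  let ?w = "\<lambda>x. if x \<in> {- M<..<M} then complex_of_real (shoot M k x) else 0"
  fix u assume "u \<in> eigenspace (T M) (k\<^sup>2)"
  then obtain u1 where s: "schroed_sol V (k\<^sup>2) (- M) M (\<lambda>x. Re (u x)) (\<lambda>x. Re (u1 x))"
      "schroed_sol V (k\<^sup>2) (- M) M (\<lambda>x. Im (u x)) (\<lambda>x. Im (u1 x))"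
    and o: "\<And>x. x \<notin> {- M<..<M} \<Longrightarrow> u x = 0"
    using eigenspace_V_E[of M u "k\<^sup>2"] assms(1) by auto
  have M0: "u M = 0" using o by simp
  obtain c where c: "\<And>x. x \<in> {- M..M} \<Longrightarrow> Re (u x) = c * shoot M k x"
    using schroed_sol_proportional[OF assms(1,2) s(1)] M0 by auto
  obtain d where d: "\<And>x. x \<in> {- M..M} \<Longrightarrow> Im (u x) = d * shoot M k x"
    using schroed_sol_proportional[OF assms(1,2) s(2)] M0 by auto
  have "u x = Complex c d * ?w x" for x
    using c[of x] d[of x] o[of x] by (auto simp: complex_eq_iff)
  then show "\<exists>c. u = (\<lambda>x. c * ?w x)" by blast
qed

lemma spectral_gap_V:
  assumes "M \<ge> 1500"
  shows "(10 - pi\<^sup>2) / M\<^sup>2 \<le> spectral_gap V (2 * M)" "spectral_gap V (2 * M) \<le> 4 * pi\<^sup>2 / M\<^sup>2"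
proof -
  have M: "M > 1" using assms by simp
  obtain k0 where k0: "0 < k0" "k0 < pi / M" "shoot M k0 (- M) = 0" using first_shoot_zero[OF assms] .
  obtain k2 where k2: "pi / M < k2" "k2 \<le> 2 * pi / M" "shoot M k2 (- M) = 0" using second_shoot_zero[OF assms] .
  \<comment> \<open>Every zero other than \<open>k0\<close> is at least \<open>sqrt 10 / M\<close>,
    so the least element of this compact set, nonempty because of \<open>k2\<close>, is the second
    zero overall.\<close>
  define Z where "Z = {k \<in> {sqrt 10 / M..2 * pi / M}. shoot M k (- M) = 0}"
  have low: "k = k0" if "0 < k" "k\<^sup>2 \<le> 10 / M\<^sup>2" "shoot M k (- M) = 0" for k
  proof -
    have "k0\<^sup>2 \<le> (pi / M)\<^sup>2" using k0 by (intro power_mono) auto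
    also have "\<dots> \<le> 10 / M\<^sup>2"
      unfolding power_divide using pi_squared_less_10 by (intro divide_right_mono) auto
    finally show ?thesis using low_shoot_zero_unique[OF assms] that k0 by (cases k k0 rule: linorder_cases) auto
  qed
  have high: "sqrt 10 / M \<le> k" if "0 < k" "k \<noteq> k0" "shoot M k (- M) = 0" for k
  proof -
    have "(sqrt 10 / M)\<^sup>2 < k\<^sup>2" using low[of k] that by (force simp: power_divide)
    then show ?thesis by (rule power2_le_imp_le[OF less_imp_le]) (use that(1) in simp)
  qed
  have "0 < k2" using k2 k0 by linarith
  then have "k2 \<in> Z" unfolding Z_def using high[of k2] k0 k2 by auto
  moreover have "compact Z"
  proof -
    have "continuous_on {sqrt 10 / M..2 * pi / M} (\<lambda>k. shoot M k (- M))"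
      using M by (intro continuous_on_shoot_Icc) auto
    then have "closed Z" unfolding Z_def by (rule continuous_closed_preimage_constant) simp
    moreover have "bounded Z" unfolding Z_def by (rule bounded_subset[of "{sqrt 10 / M..2 * pi / M}"]) auto
    ultimately show ?thesis by (simp add: compact_eq_bounded_closed)
  qed
  ultimately obtain k1 where k1: "k1 \<in> Z" "\<And>k. k \<in> Z \<Longrightarrow> k1 \<le> k"
    using compact_attains_inf[of Z] by blast
  have "pi / M < sqrt 10 / M"
  proof -
    have "pi < sqrt 10" by (rule real_less_rsqrt[OF pi_squared_less_10])
    then show ?thesis using M by (simp add: divide_strict_right_mono)
  qed
  then have k01: "k0 < k1" "0 < k1" "sqrt 10 / M \<le> k1" "k1 \<le> 2 * pi / M" "shoot M k1 (- M) = 0"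
    using k1(1) k0 unfolding Z_def by auto
  have lt: "k0\<^sup>2 < k1\<^sup>2" using k0 k01 by (intro power_strict_mono) auto
  have e: "is_eigenvalue (T M) (k0\<^sup>2)" "is_eigenvalue (T M) (k1\<^sup>2)"
    using is_eigenvalue_V_iff[OF M] k0 k01 by blast+
  have only: "\<mu> = k0\<^sup>2 \<or> \<mu> = k1\<^sup>2" if ev: "is_eigenvalue (T M) \<mu>" "\<mu> \<le> k1\<^sup>2" for \<mu>
  proof -
    obtain k where k: "k > 0" "\<mu> = k\<^sup>2" "shoot M k (- M) = 0"
      using is_eigenvalue_V_iff[OF M] ev(1) by blast
    have "k\<^sup>2 \<le> k1\<^sup>2" using ev(2) k(2) by simp
    then have le: "k \<le> k1" by (rule power2_le_imp_le) (use k01(2) in simp)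
    have "k1 \<le> k" if "k \<noteq> k0"
      by (rule k1(2)) (use high[OF k(1) that k(3)] le k01(4) k(3) in \<open>simp add: Z_def\<close>)
    with le k(2) show ?thesis by (cases "k = k0") auto
  qed
  have gap: "spectral_gap V (2 * M) = k1\<^sup>2 - k0\<^sup>2"
    unfolding spectral_gap_def
    using nth_eigenvalue_0_1[OF e lt only] eigenvalue_mult_V[OF M] k0 k01 by simp
  have "k0\<^sup>2 \<le> (pi / M)\<^sup>2" "(sqrt 10 / M)\<^sup>2 \<le> k1\<^sup>2" "k1\<^sup>2 \<le> (2 * pi / M)\<^sup>2"
    using k0 k01 M by (intro power_mono; simp)+
  then have "k0\<^sup>2 \<le> pi\<^sup>2 / M\<^sup>2" "10 / M\<^sup>2 \<le> k1\<^sup>2" "k1\<^sup>2 \<le> 4 * pi\<^sup>2 / M\<^sup>2"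
    by (simp_all add: power_divide power_mult_distrib)
  then show "(10 - pi\<^sup>2) / M\<^sup>2 \<le> spectral_gap V (2 * M)" "spectral_gap V (2 * M) \<le> 4 * pi\<^sup>2 / M\<^sup>2"
    unfolding gap diff_divide_distrib using zero_le_power2[of k0] by linarith+
qed

theorem theorem2p7:
  shows "\<exists>\<alpha> \<beta> :: real. 0 < \<alpha> \<and> \<alpha> < \<beta> \<and>
    (\<forall>\<^sub>F L :: real in at_top.
       \<alpha> / L\<^sup>2 \<le> spectral_gap inverse_square_potential L \<and>
       spectral_gap inverse_square_potential L \<le> \<beta> / L\<^sup>2)"
proof (intro exI conjI)
  have "3\<^sup>2 \<le> pi\<^sup>2" using pi_gt3 by (intro power_mono) auto
  with pi_squared_less_10 show "0 < 4 * (10 - pi\<^sup>2)" "4 * (10 - pi\<^sup>2) < 16 * pi\<^sup>2" by simp_all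
  show "\<forall>\<^sub>F L in at_top. 4 * (10 - pi\<^sup>2) / L\<^sup>2 \<le> spectral_gap V L \<and> spectral_gap V L \<le> 16 * pi\<^sup>2 / L\<^sup>2"
    \<comment> \<open>The threshold is \<open>2 * 1500\<close>, and replacing \<open>M\<close> by
      \<open>L / 2\<close> multiplies both constants by 4.\<close>
    using eventually_ge_at_top[of 3000]
  proof eventually_elim
    case (elim L)
    have "4 * (10 - pi\<^sup>2) / L\<^sup>2 = (10 - pi\<^sup>2) / (L / 2)\<^sup>2" "16 * pi\<^sup>2 / L\<^sup>2 = 4 * pi\<^sup>2 / (L / 2)\<^sup>2"
      by (simp_all add: power_divide)
    moreover have "2 * (L / 2) = L" by simp
    ultimately show ?case using spectral_gap_V[of "L / 2"] elim by (simp only:)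
  qed
qed

end
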